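(* Let $\{\varphi_i\}_{i=1}^N$ be a conformal iterated function system and $F \subset \mathbb{R}^d$ the associated self-conformal set, containing at least two points. Let $V$ be the bounded open convex set fixed in the context. If $F$ does not satisfy the identity limit criterion, then there exists a constant $C \ge 1$ such that for every $\varepsilon>0$ there are $0<\delta<\varepsilon$ and $\mathtt{i},\mathtt{j} \in \Sigma_*$ for which $$C^{-1}\delta \max\{\|\varphi_{\mathtt{i}}'\|,\|\varphi_{\mathtt{j}}'\|\} \le |\varphi_{\mathtt{i}}(x)-\varphi_{\mathtt{j}}(x)| \le C\delta \min\{\|\varphi_{\mathtt{i}}'\|,\|\varphi_{\mathtt{j}}'\|\}$$ for all $x \in V$.
   Context: Conformal maps and self-conformal sets: let $\Omega \subset \mathbb{R}^d$ be open. A $C^1$-mapping $\varphi \colon \Omega \to \mathbb{R}^d$ is conformal if for every $x\in\Omega$ the differential $\varphi'(x)$ is a similarity, i.e. $|\varphi'(x)y| = |\varphi'(x)||y| \ne 0$ for all $y \in \mathbb{R}^d \setminus \{0\}$ (where $|\varphi'(x)|$ is the operator norm), and $x \mapsto \varphi'(x)$ is Hölder continuous: there exist $\alpha,c>0$ with $|\varphi'(x) - \varphi'(y)| \le c|x-y|^\alpha$ for all $x,y \in \Omega$. (For $d=1$ these are the $C^{1+\alpha}$-functions with non-vanishing derivative.) A finite family $\{\varphi_i\}_{i=1}^N$, $N \ge 2$, is a conformal iterated function system if each $\varphi_i$ is an injective conformal mapping on a common non-empty bounded open convex set $\Omega \subset \mathbb{R}^d$ such that $\overline{\varphi_i(\Omega)}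 \subset \Omega$ and $\|\varphi_i'\| := \sup_{x \in \Omega}|\varphi_i'(x)| < 1$. The associated self-conformal set is the unique non-empty compact set $F \subset \Omega$ with $F = \bigcup_{i=1}^N \varphi_i(F)$. The set $V$: a non-empty bounded open convex set $V\subset\mathbb{R}^d$ with $\varphi_i(\overline{V}) \subset V \subset \overline{V} \subset \Omega$ for all $i \in \{1,\dots,N\}$ (such a set always exists, and $F\subset V$) is fixed. Words: $\Sigma_*$ is the set of all finite words (including the empty word $\varnothing$) over $\{1,\dots,N\}$. For $\mathtt{i}=i_1\cdots i_n$, $\varphi_{\mathtt{i}} = \varphi_{i_1}\circ\cdots\circ\varphi_{i_n}$, with $\varphi_\varnothing$ the identity, and $\|\varphi_{\mathtt{i}}'\| = \sup_{x\in\Omega}|\varphi_{\mathtt{i}}'(x)|$. Identity limit criterion: $\inf\{ \|\varphi_{\mathtt{i}}'\|^{-1} \sup_{x \in F}|\varphi_{\mathtt{i}}(x)-\varphi_{\mathtt{j}}(x)| : \mathtt{i},\mathtt{j} \in \Sigma_* \text{ such that } \varphi_{\mathtt{i}}|_F \ne \varphi_{\mathtt{j}}|_F \} > 0$. *)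

theory Defs
  imports "HOL-Analysis.Analysis"
begin

text \<open>
  The ambient space \<open>\<real>\<^sup>d\<close> is an arbitrary type of class \<open>euclidean_space\<close>. Maps on the open set
  \<open>\<Omega>\<close> are total functions whose values outside \<open>\<Omega>\<close> are never used. The differential is taken as a
  bounded linear map, so that \<open>norm\<close> is the operator norm.
\<close>

definition differential :: "('a::euclidean_space \<Rightarrow> 'a) \<Rightarrow> 'a \<Rightarrow> 'a \<Rightarrow>\<^sub>L 'a" where
  "differential f x = Blinfun (frechet_derivative f (at x))"

definition conformal_on :: "'a::euclidean_space set \<Rightarrow> ('a \<Rightarrow> 'a) \<Rightarrow> bool" where
  "conformal_on \<Omega> f \<longleftrightarrow>
     (\<forall>x\<in>\<Omega>. f differentiable (at x)) \<and>
     continuous_on \<Omega> (differential f) \<and>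
     (\<forall>x\<in>\<Omega>. \<forall>y. y \<noteq> 0 \<longrightarrow>
        norm (blinfun_apply (differential f x) y) = norm (differential f x) * norm y \<and>
        norm (differential f x) * norm y \<noteq> 0) \<and>
     (\<exists>\<alpha>>0. \<exists>c>0. \<forall>x\<in>\<Omega>. \<forall>y\<in>\<Omega>.
        norm (differential f x - differential f y) \<le> c * norm (x - y) powr \<alpha>)"

text \<open>
  The supremum is over a non-empty bounded set of reals whenever \<open>f\<close> is conformal on a non-empty
  bounded \<open>\<Omega>\<close> (by Hoelder continuity), and for all compositions of such self-maps of \<open>\<Omega>\<close>.
\<close>

definition deriv_norm :: "'a::euclidean_space set \<Rightarrow> ('a \<Rightarrow> 'a) \<Rightarrow> real" where
  "deriv_norm \<Omega> f = (SUP x\<in>\<Omega>. norm (differential f x))"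

definition conformal_ifs ::
    "'a::euclidean_space set \<Rightarrow> nat \<Rightarrow> (nat \<Rightarrow> 'a \<Rightarrow> 'a) \<Rightarrow> bool" where
  "conformal_ifs \<Omega> N \<phi> \<longleftrightarrow>
     N \<ge> 2 \<and> \<Omega> \<noteq> {} \<and> bounded \<Omega> \<and> open \<Omega> \<and> convex \<Omega> \<and>
     (\<forall>i\<in>{1..N}. inj_on (\<phi> i) \<Omega> \<and> conformal_on \<Omega> (\<phi> i) \<and>
        closure (\<phi> i ` \<Omega>) \<subseteq> \<Omega> \<and> deriv_norm \<Omega> (\<phi> i) < 1)"

definition self_conformal_set ::
    "'a::euclidean_space set \<Rightarrow> nat \<Rightarrow> (nat \<Rightarrow> 'a \<Rightarrow> 'a) \<Rightarrow> 'a set \<Rightarrow> bool" where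
  "self_conformal_set \<Omega> N \<phi> F \<longleftrightarrow>
     F \<noteq> {} \<and> compact F \<and> F \<subseteq> \<Omega> \<and> F = (\<Union>i\<in>{1..N}. \<phi> i ` F)"

definition words :: "nat \<Rightarrow> nat list set" where
  "words N = lists {1..N}"

fun word_map :: "(nat \<Rightarrow> 'a \<Rightarrow> 'a) \<Rightarrow> nat list \<Rightarrow> 'a \<Rightarrow> 'a" where
  "word_map \<phi> [] = id"
| "word_map \<phi> (i # w) = \<phi> i \<circ> word_map \<phi> w"

text \<open>
  The outer infimum is taken in the extended reals, so that the infimum of the empty set is
  \<open>\<infinity>\<close>; the inner supremum is over a compact set of reals.
\<close>

definition identity_limit_criterion ::
    "'a::euclidean_space set \<Rightarrow> nat \<Rightarrow> (nat \<Rightarrow> 'a \<Rightarrow> 'a) \<Rightarrow> 'a set \<Rightarrow> bool" where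
  "identity_limit_criterion \<Omega> N \<phi> F \<longleftrightarrow>
     Inf {ereal (inverse (deriv_norm \<Omega> (word_map \<phi> u)) *
                 (SUP x\<in>F. norm (word_map \<phi> u x - word_map \<phi> v x))) | u v.
          u \<in> words N \<and> v \<in> words N \<and>
          restrict (word_map \<phi> u) F \<noteq> restrict (word_map \<phi> v) F} > 0"

end

theory Submission
  imports Defs
begin

text \<open>
  Write \<open>D w\<close> for the differential of the word map \<open>\<phi>\<^sub>w\<close>. Bounded distortion reduces the claim to finding,
  for every \<open>\<tau> > 0\<close>, words \<open>p, q\<close> and a point \<open>z \<in> F\<close> with
  \<open>0 < |\<phi>\<^sub>p z - \<phi>\<^sub>q z| \<le> \<tau> \<parallel>\<phi>\<^sub>p'\<parallel>\<close> and \<open>|D p z - D q z| \<le> \<tau> \<parallel>\<phi>\<^sub>p'\<parallel>\<close>: precomposing with a word \<open>w\<close> that codes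
  \<open>z\<close> and contracts by a large multiple of \<open>|\<phi>\<^sub>p z - \<phi>\<^sub>q z| / \<parallel>\<phi>\<^sub>p'\<parallel>\<close> makes the difference almost constant.

  Failure of the identity limit criterion gives pairs \<open>(u\<^sub>n, v\<^sub>n)\<close> that are close on \<open>F\<close>, but \<open>F\<close> may be too
  thin (for instance contained in a line) to control the differentials: \<open>v\<^sub>n\<close> may be close to \<open>u\<^sub>n\<close>
  composed with a reflection fixing \<open>F\<close>. The remedy is to compose two pairs \<open>(a, b)\<close> and \<open>(u, v)\<close> of
  asymptotically equal type crosswise and to compare \<open>u k b\<close> with \<open>v k a\<close>. The filler \<open>k\<close> is chosen so that
  \<open>k a\<close> is a power of one word whose differential is nearly a scalar; then the differential of \<open>k\<close>
  nearly inverts that of \<open>a\<close>, which makes the two composite differentials nearly equal. Since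
  \<open>(u, v)\<close> is chosen last and is much closer than \<open>(a, b)\<close>, the composite maps are still distinct.
\<close>

section \<open>Similarities and word maps\<close>

definition similarity :: "('a::real_normed_vector \<Rightarrow>\<^sub>L 'a) \<Rightarrow> bool" where
  "similarity A \<longleftrightarrow> A \<noteq> 0 \<and> (\<forall>y. norm (blinfun_apply A y) = norm A * norm y)"

lemma similarity_norm_apply: "similarity A \<Longrightarrow> norm (blinfun_apply A y) = norm A * norm y"
  by (simp add: similarity_def)

lemma similarity_norm_pos: "similarity A \<Longrightarrow> 0 < norm A"
  by (simp add: similarity_def)

text \<open>\<open>A\<close> stretches every vector by exactly \<open>norm A\<close>, so
  \<open>norm (B y)\<close> is recovered from \<open>norm ((A o\<^sub>L B) y)\<close> by
  division.\<close>

lemma similarity_norm_compose_left: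
  assumes "similarity A"
  shows "norm (A o\<^sub>L B) = norm A * norm B"
proof (rule antisym)
  show "norm (A o\<^sub>L B) \<le> norm A * norm B"
    by (rule norm_blinfun_compose)
  have "norm B \<le> norm (A o\<^sub>L B) / norm A"
  proof (rule norm_blinfun_bound)
    fix y
    have "norm A * norm (B y) = norm ((A o\<^sub>L B) y)"
      using assms by (simp add: similarity_norm_apply)
    also have "\<dots> \<le> norm (A o\<^sub>L B) * norm y"
      by (rule norm_blinfun)
    finally show "norm (B y) \<le> norm (A o\<^sub>L B) / norm A * norm y"
      using similarity_norm_pos[OF assms] by (simp add: field_simps)
  qed simp
  then show "norm A * norm B \<le> norm (A o\<^sub>L B)"
    using similarity_norm_pos[OF assms] by (simp add: field_simps)
qed

text \<open>In finite dimension the injective map \<open>A\<close> is onto, so every argument of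
  \<open>B\<close> has the form \<open>A x\<close> with length
  \<open>norm A * norm x\<close>.\<close>

lemma similarity_norm_compose_right:
  fixes A :: "'a::euclidean_space \<Rightarrow>\<^sub>L 'a"
  assumes "similarity A"
  shows "norm (B o\<^sub>L A) = norm B * norm A"
proof (rule antisym)
  show "norm (B o\<^sub>L A) \<le> norm B * norm A"
    by (rule norm_blinfun_compose)
  have pos: "0 < norm A"
    using assms by (rule similarity_norm_pos)
  have lin: "linear (blinfun_apply A)"
    by (simp add: blinfun.bounded_linear_right bounded_linear.linear)
  have "inj (blinfun_apply A)"
    unfolding linear_injective_0[OF lin] using similarity_norm_apply[OF assms] pos
    by (metis norm_eq_zero mult_eq_0_iff less_irrefl)
  then have surj: "surj (blinfun_apply A)"
    using lin linear_injective_imp_surjective by blast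
  have "norm B \<le> norm (B o\<^sub>L A) / norm A"
  proof (rule norm_blinfun_bound)
    fix y
    obtain x where x: "y = A x"
      using surj by (metis surjD)
    have "norm (B y) = norm ((B o\<^sub>L A) x)"
      using x by simp
    also have "\<dots> \<le> norm (B o\<^sub>L A) * norm x"
      by (rule norm_blinfun)
    finally show "norm (B y) \<le> norm (B o\<^sub>L A) / norm A * norm y"
      using x pos by (simp add: similarity_norm_apply[OF assms])
  qed simp
  then show "norm B * norm A \<le> norm (B o\<^sub>L A)"
    using pos by (simp add: field_simps)
qed

lemma similarity_compose:
  assumes "similarity A" "similarity B"
  shows "similarity (A o\<^sub>L B)"
proof -
  have norm: "norm (A o\<^sub>L B) = norm A * norm B"
    using assms(1) by (rule similarity_norm_compose_left)
  have "A o\<^sub>L B \<noteq> 0"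
    using norm similarity_norm_pos assms by (metis mult_pos_pos norm_zero less_irrefl)
  then show ?thesis
    using assms norm by (simp add: similarity_def mult.assoc)
qed

lemma similarity_id: "similarity (id_blinfun :: 'a::euclidean_space \<Rightarrow>\<^sub>L 'a)"
proof -
  have "norm (id_blinfun :: 'a \<Rightarrow>\<^sub>L 'a) = 1"
    by simp
  then have "(id_blinfun :: 'a \<Rightarrow>\<^sub>L 'a) \<noteq> 0"
    by force
  then show ?thesis
    by (simp add: similarity_def)
qed

section \<open>Differentials and word maps\<close>

lemma has_derivative_differential:
  assumes "f differentiable (at x)"
  shows "(f has_derivative blinfun_apply (differential f x)) (at x)"
  using assms frechet_derivative_works has_derivative_bounded_linear
  by (metis bounded_linear_Blinfun_apply differential_def)

lemma differential_eqI:
  assumes "(f has_derivative blinfun_apply A) (at x)"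
  shows "differential f x = A"
  using frechet_derivative_at[OF assms] by (metis blinfun_apply_inverse differential_def)

lemma word_map_append: "word_map \<phi> (u @ v) = word_map \<phi> u \<circ> word_map \<phi> v"
  by (induction u) (auto simp: o_assoc)

lemma word_map_append_apply: "word_map \<phi> (u @ v) x = word_map \<phi> u (word_map \<phi> v x)"
  by (simp add: word_map_append)

declare word_map.simps [simp del]

lemma word_map_Nil: "word_map \<phi> [] = (\<lambda>x. x)"
  by (simp add: word_map.simps id_def)

lemma word_map_single: "word_map \<phi> [i] = \<phi> i"
  by (simp add: word_map.simps)

lemma word_map_Cons: "word_map \<phi> (i # w) = (\<lambda>x. \<phi> i (word_map \<phi> w x))"
  by (simp add: word_map.simps o_def)

lemma words_Nil [simp]: "[] \<in> words N"
  by (simp add: words_def)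

lemma words_Cons [simp]: "i # w \<in> words N \<longleftrightarrow> i \<in> {1..N} \<and> w \<in> words N"
  by (auto simp: words_def)

lemma words_append [simp]: "u @ v \<in> words N \<longleftrightarrow> u \<in> words N \<and> v \<in> words N"
  by (auto simp: words_def)

section \<open>Elementary inequalities and uniform constants\<close>

text \<open>The difference splits into \<open>(a - b) /\<^sub>R norm a\<close> and a rescaling of
  \<open>b\<close>; each part costs at most \<open>norm (a - b) / norm a\<close>, hence the factor
  2.\<close>

lemma norm_diff_normalized_le:
  fixes a b :: "'a::real_normed_vector"
  assumes "a \<noteq> 0" "b \<noteq> 0"
  shows "norm (a /\<^sub>R norm a - b /\<^sub>R norm b) \<le> 2 * norm (a - b) / norm a"
proof -
  have "norm (a /\<^sub>R norm a - b /\<^sub>R norm b) =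
      norm ((a - b) /\<^sub>R norm a + (1 / norm a - 1 / norm b) *\<^sub>R b)"
    by (simp add: algebra_simps inverse_eq_divide)
  also have "\<dots> \<le> norm (a - b) / norm a + \<bar>1 / norm a - 1 / norm b\<bar> * norm b"
    by (rule order_trans[OF norm_triangle_ineq]) (simp add: divide_inverse mult.commute)
  also have "\<bar>1 / norm a - 1 / norm b\<bar> * norm b = \<bar>norm b - norm a\<bar> / norm a"
  proof -
    have "\<bar>1 / norm a - 1 / norm b\<bar> * norm b = \<bar>(1 / norm a - 1 / norm b) * norm b\<bar>"
      by (simp add: abs_mult)
    also have "(1 / norm a - 1 / norm b) * norm b = (norm b - norm a) / norm a"
      using assms by (simp add: field_simps)
    finally show ?thesis by simp
  qed
  also have "\<bar>norm b - norm a\<bar> \<le> norm (a - b)"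
    by (metis norm_minus_commute norm_triangle_ineq3)
  finally show ?thesis
    using assms by (simp add: divide_right_mono field_simps)
qed

text \<open>Merges the constants of finitely many maps: when a property persists as its parameter
  shrinks, the minimum of the individual thresholds serves all indices.\<close>

lemma finite_uniform_pos:
  fixes P :: "'i \<Rightarrow> real \<Rightarrow> bool"
  assumes "finite I" "\<And>i. i \<in> I \<Longrightarrow> \<exists>d>0. \<forall>e. 0 < e \<longrightarrow> e \<le> d \<longrightarrow> P i e"
  shows "\<exists>e>0. \<forall>i\<in>I. P i e"
proof -
  obtain d where d: "\<And>i. i \<in> I \<Longrightarrow> 0 < d i \<and> (\<forall>e. 0 < e \<longrightarrow> e \<le> d i \<longrightarrow> P i e)"
    using assms(2) by metis
  define e where "e = Min (insert 1 (d ` I))"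
  have "0 < e" "\<And>i. i \<in> I \<Longrightarrow> e \<le> d i"
    using d assms(1) by (auto simp: e_def)
  then show ?thesis
    using d by blast
qed

text \<open>Puts a Hoelder bound into a one-parameter form, exponent \<open>e\<close> and constant
  \<open>1 / e\<close>, that survives decreasing \<open>e\<close> as
  \<open>finite_uniform_pos\<close> demands. Lowering the exponent costs at most
  \<open>R powr \<alpha>\<close>, which \<open>c * R powr \<alpha> \<le> 1 / e\<close>
  absorbs.\<close>

lemma hoelder_exponent_decrease:
  fixes r R \<alpha> c e :: real
  assumes "0 \<le> r" "r \<le> R" "1 \<le> R" "0 < c" "0 < e" "e \<le> min \<alpha> (1 / (c * R powr \<alpha>))"
  shows "c * r powr \<alpha> \<le> 1 / e * r powr e"
proof -
  have R: "0 < c * R powr \<alpha>"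
    using assms by simp
  have "r powr \<alpha> = r powr (\<alpha> - e) * r powr e"
    by (simp flip: powr_add)
  also have "\<dots> \<le> R powr \<alpha> * r powr e"
  proof (rule mult_right_mono)
    have "r powr (\<alpha> - e) \<le> R powr (\<alpha> - e)"
      using assms by (intro powr_mono2) auto
    also have "\<dots> \<le> R powr \<alpha>"
      using assms by (intro powr_mono) auto
    finally show "r powr (\<alpha> - e) \<le> R powr \<alpha>" .
  qed simp
  finally have "c * r powr \<alpha> \<le> (c * R powr \<alpha>) * r powr e"
    using assms(4) by (simp add: mult.assoc)
  also have "\<dots> \<le> 1 / e * r powr e"
    using assms R by (intro mult_right_mono) (auto simp: field_simps)
  finally show ?thesis .
qed

section \<open>Bounded distortion\<close>

text \<open>
  The set \<open>K\<close> is where lower bounds on the differentials hold; on \<open>\<Omega>\<close> itself the differentials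
  may degenerate towards the boundary. It will be \<open>F \<union> closure V\<close>.
\<close>

locale conformal_system =
  fixes \<Omega> K :: "'a::euclidean_space set" and N :: nat and \<phi> :: "nat \<Rightarrow> 'a \<Rightarrow> 'a"
    and lam \<alpha> c m R :: real
  assumes convex_\<Omega>: "convex \<Omega>"
    and R: "0 < R" "\<And>x y. x \<in> \<Omega> \<Longrightarrow> y \<in> \<Omega> \<Longrightarrow> norm (x - y) \<le> R"
    and K: "K \<subseteq> \<Omega>" "K \<noteq> {}" "\<And>i x. i \<in> {1..N} \<Longrightarrow> x \<in> K \<Longrightarrow> \<phi> i x \<in> K"
    and maps: "\<And>i x. i \<in> {1..N} \<Longrightarrow> x \<in> \<Omega> \<Longrightarrow> \<phi> i x \<in> \<Omega>"
    and inj: "\<And>i. i \<in> {1..N} \<Longrightarrow> inj_on (\<phi> i) \<Omega>"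
    and diff: "\<And>i x. i \<in> {1..N} \<Longrightarrow> x \<in> \<Omega> \<Longrightarrow> \<phi> i differentiable (at x)"
    and sim: "\<And>i x. i \<in> {1..N} \<Longrightarrow> x \<in> \<Omega> \<Longrightarrow> similarity (differential (\<phi> i) x)"
    and lam: "0 < lam" "lam < 1"
      "\<And>i x. i \<in> {1..N} \<Longrightarrow> x \<in> \<Omega> \<Longrightarrow> norm (differential (\<phi> i) x) \<le> lam"
    and m: "0 < m" "\<And>i x. i \<in> {1..N} \<Longrightarrow> x \<in> K \<Longrightarrow> m \<le> norm (differential (\<phi> i) x)"
    and hoelder: "0 < \<alpha>" "0 < c"
      "\<And>i x y. i \<in> {1..N} \<Longrightarrow> x \<in> \<Omega> \<Longrightarrow> y \<in> \<Omega> \<Longrightarrow>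
        norm (differential (\<phi> i) x - differential (\<phi> i) y) \<le> c * norm (x - y) powr \<alpha>"
begin

abbreviation W :: "nat list \<Rightarrow> 'a \<Rightarrow> 'a" where "W \<equiv> word_map \<phi>"
abbreviation D :: "nat list \<Rightarrow> 'a \<Rightarrow> 'a \<Rightarrow>\<^sub>L 'a" where "D w \<equiv> differential (W w)"
abbreviation nrm :: "nat list \<Rightarrow> real" where "nrm w \<equiv> deriv_norm \<Omega> (W w)"

section \<open>Chain rule and derivative norms of words\<close>

lemma W_in_\<Omega>: "w \<in> words N \<Longrightarrow> x \<in> \<Omega> \<Longrightarrow> W w x \<in> \<Omega>"
  by (induction w) (auto simp: word_map_Nil word_map_Cons intro: maps)

lemma W_in_K: "w \<in> words N \<Longrightarrow> x \<in> K \<Longrightarrow> W w x \<in> K"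
  by (induction w) (auto simp: word_map_Nil word_map_Cons intro: K(3))

lemma inj_on_W: "w \<in> words N \<Longrightarrow> inj_on (W w) \<Omega>"
proof (induction w)
  case (Cons i w)
  then show ?case
    using comp_inj_on[of "W w" \<Omega> "\<phi> i"] inj_on_subset[OF inj, of i "W w ` \<Omega>"] W_in_\<Omega>[of w]
    by (auto simp: word_map_Cons o_def)
qed (simp add: word_map_Nil)

lemma W_differentiable: "w \<in> words N \<Longrightarrow> x \<in> \<Omega> \<Longrightarrow> W w differentiable (at x)"
proof (induction w)
  case (Cons i w)
  then show ?case
    using W_in_\<Omega>[of w x] diff[of i "W w x"] differentiable_chain_at[of "W w" x "\<phi> i"]
    by (auto simp: word_map_Cons o_def)
qed (simp add: word_map_Nil)

lemma W_has_derivative: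
  "w \<in> words N \<Longrightarrow> x \<in> \<Omega> \<Longrightarrow> (W w has_derivative blinfun_apply (D w x)) (at x)"
  by (intro has_derivative_differential W_differentiable)

lemma D_Nil: "D [] x = id_blinfun"
  by (rule differential_eqI) (simp add: word_map_Nil id_blinfun.rep_eq id_def)

lemma D_append:
  assumes "u \<in> words N" "v \<in> words N" "x \<in> \<Omega>"
  shows "D (u @ v) x = D u (W v x) o\<^sub>L D v x"
proof (rule differential_eqI)
  show "(W (u @ v) has_derivative blinfun_apply (D u (W v x) o\<^sub>L D v x)) (at x)"
    using diff_chain_at[OF W_has_derivative[OF assms(2,3)]
        W_has_derivative[OF assms(1) W_in_\<Omega>[OF assms(2,3)]]]
    by (simp add: word_map_append o_def blinfun_compose.rep_eq)
qed

lemma D_Cons: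
  assumes "i \<in> {1..N}" "w \<in> words N" "x \<in> \<Omega>"
  shows "D (i # w) x = differential (\<phi> i) (W w x) o\<^sub>L D w x"
  using D_append[of "[i]" w x] assms by (simp add: word_map_single)

lemma D_similarity: "w \<in> words N \<Longrightarrow> x \<in> \<Omega> \<Longrightarrow> similarity (D w x)"
proof (induction w)
  case (Cons i w)
  then show ?case
    by (simp add: D_Cons similarity_compose sim W_in_\<Omega>)
qed (use D_Nil similarity_id in simp)

lemma norm_D_pos: "w \<in> words N \<Longrightarrow> x \<in> \<Omega> \<Longrightarrow> 0 < norm (D w x)"
  using D_similarity similarity_norm_pos by blast

text \<open>Equality holds because the outer differential is a similarity; this is the source of
  lower bounds along words.\<close>

lemma norm_D_append:
  assumes "u \<in> words N" "v \<in> words N" "x \<in> \<Omega>"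
  shows "norm (D (u @ v) x) = norm (D u (W v x)) * norm (D v x)"
  using assms by (simp add: D_append similarity_norm_compose_left D_similarity W_in_\<Omega>)

lemma norm_D_le_power: "w \<in> words N \<Longrightarrow> x \<in> \<Omega> \<Longrightarrow> norm (D w x) \<le> lam ^ length w"
proof (induction w)
  case (Cons i w)
  then have "norm (D (i # w) x) = norm (differential (\<phi> i) (W w x)) * norm (D w x)"
    using norm_D_append[of "[i]" w x] by (simp add: word_map_single)
  also have "\<dots> \<le> lam * lam ^ length w"
    using Cons lam W_in_\<Omega> by (intro mult_mono) auto
  finally show ?case by simp
qed (use D_Nil in simp)

lemma \<Omega>_nonempty: "\<Omega> \<noteq> {}"
  using K by blast

text \<open>The bound \<open>lam ^ length w\<close> makes the supremum in \<open>deriv_norm\<close>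
  one of a bounded set, so that it dominates each value.\<close>

lemma norm_D_le_nrm: "w \<in> words N \<Longrightarrow> x \<in> \<Omega> \<Longrightarrow> norm (D w x) \<le> nrm w"
  unfolding deriv_norm_def
  by (intro cSUP_upper bdd_aboveI2[where M = "lam ^ length w"]) (auto intro: norm_D_le_power)

lemma nrm_le: "(\<And>x. x \<in> \<Omega> \<Longrightarrow> norm (D w x) \<le> B) \<Longrightarrow> nrm w \<le> B"
  unfolding deriv_norm_def using \<Omega>_nonempty by (intro cSUP_least) auto

lemma nrm_le_power: "w \<in> words N \<Longrightarrow> nrm w \<le> lam ^ length w"
  by (intro nrm_le norm_D_le_power)

lemma nrm_le_1: "w \<in> words N \<Longrightarrow> nrm w \<le> 1"
  using nrm_le_power[of w] lam by (meson order_trans power_le_one less_imp_le)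

lemma nrm_pos: "w \<in> words N \<Longrightarrow> 0 < nrm w"
  using norm_D_pos norm_D_le_nrm \<Omega>_nonempty by (meson ex_in_conv less_le_trans)

lemma nrm_append_le:
  assumes "u \<in> words N" "v \<in> words N"
  shows "nrm (u @ v) \<le> nrm u * nrm v"
proof (rule nrm_le)
  fix x assume "x \<in> \<Omega>"
  then show "norm (D (u @ v) x) \<le> nrm u * nrm v"
    using assms less_imp_le[OF nrm_pos[of u]]
    by (auto simp: norm_D_append intro!: mult_mono norm_D_le_nrm W_in_\<Omega>)
qed

lemma W_lipschitz:
  assumes "w \<in> words N" "x \<in> \<Omega>" "y \<in> \<Omega>"
  shows "norm (W w x - W w y) \<le> nrm w * norm (x - y)"
proof (rule differentiable_bound[OF convex_\<Omega> _ _ assms(2,3)])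
  fix z assume z: "z \<in> \<Omega>"
  show "(W w has_derivative blinfun_apply (D w z)) (at z within \<Omega>)"
    using W_has_derivative[OF assms(1) z] by (rule has_derivative_at_withinI)
  show "onorm (blinfun_apply (D w z)) \<le> nrm w"
    using norm_D_le_nrm[OF assms(1) z] by (simp add: norm_blinfun.rep_eq)
qed

section \<open>Distortion estimates\<close>

text \<open>\<open>c / m\<close> is the relative Hoelder constant of a single map on
  \<open>K\<close>, and \<open>1 / (1 - lam powr \<alpha>)\<close> sums the geometric series of the
  contracted distances along a word.\<close>

definition Q :: real where "Q = c / m / (1 - lam powr \<alpha>)"

text \<open>The factor \<open>1 + Q\<close> lets one constant dominate both
  \<open>Q * exp (Q * R powr \<alpha>)\<close> and \<open>exp (Q * R powr \<alpha>)\<close>.\<close>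

definition C :: real where "C = (1 + Q) * exp (Q * R powr \<alpha>)"

lemma theta: "0 < lam powr \<alpha>" "lam powr \<alpha> < 1"
  using lam hoelder(1,2) powr_less_mono2[of \<alpha> lam 1] by auto

lemma Q_pos: "0 < Q"
  using theta m hoelder(1,2) by (simp add: Q_def)

lemma C_ge_1: "1 \<le> C"
  using Q_pos R mult_mono[of 1 "1 + Q" 1 "exp (Q * R powr \<alpha>)"] by (simp add: C_def)

text \<open>Induction on the outermost letter. Its two arguments are images under the remaining
  \<open>n\<close> letters, at distance at most \<open>lam ^ n * norm (x - y)\<close>, so its
  relative error \<open>t\<close> decays geometrically; the errors multiply and
  \<open>1 + t \<le> exp t\<close>. Making the error relative uses
  \<open>m \<le> norm (E y)\<close>, hence \<open>y \<in> K\<close>.\<close>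

lemma distortion_aux:
  assumes "w \<in> words N" "x \<in> \<Omega>" "y \<in> K"
  shows "norm (D w x - D w y) \<le>
    (exp (c / m * norm (x - y) powr \<alpha> * (\<Sum>k<length w. (lam powr \<alpha>) ^ k)) - 1) * norm (D w y)"
  using assms(1)
proof (induction w)
  case Nil
  then show ?case by (simp add: D_Nil)
next
  case (Cons i w)
  define r where "r = norm (x - y) powr \<alpha>"
  define n where "n = length w"
  define S where "S = c / m * r * (\<Sum>k<n. (lam powr \<alpha>) ^ k)"
  define t where "t = c / m * r * (lam powr \<alpha>) ^ n"
  define E where "E x = differential (\<phi> i) (W w x)" for x
  have i: "i \<in> {1..N}" and w: "w \<in> words N"
    using Cons by auto
  have y: "y \<in> \<Omega>"
    using K assms by auto
  have t0: "0 \<le> t"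
    using m hoelder(1,2) by (simp add: t_def r_def)
  have IH: "norm (D w x - D w y) \<le> (exp S - 1) * norm (D w y)"
    using Cons.IH[OF w] by (simp add: S_def r_def n_def)
  have Dx: "norm (D w x) \<le> exp S * norm (D w y)"
    using IH norm_triangle_ineq2[of "D w x" "D w y"] by (simp add: algebra_simps)
  have "norm (E x - E y) \<le> c * norm (W w x - W w y) powr \<alpha>"
    unfolding E_def by (intro hoelder(3) i W_in_\<Omega> w assms y)
  also have "\<dots> \<le> c * (lam ^ n * norm (x - y)) powr \<alpha>"
  proof (intro mult_left_mono powr_mono2)
    show "norm (W w x - W w y) \<le> lam ^ n * norm (x - y)"
      unfolding n_def
      by (rule order_trans[OF W_lipschitz[OF w assms(2) y] mult_right_mono[OF nrm_le_power[OF w]]]) simp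
  qed (use hoelder(1,2) in auto)
  also have "\<dots> = c * (lam powr \<alpha>) ^ n * r"
  proof -
    have "(lam ^ n) powr \<alpha> = (lam powr \<alpha>) ^ n"
      using lam(1) by (simp add: powr_powr mult.commute flip: powr_realpow)
    then show ?thesis
      by (simp add: powr_mult r_def mult.assoc)
  qed
  also have "\<dots> = t * m"
    using m by (simp add: t_def)
  also have "\<dots> \<le> t * norm (E y)"
    using m W_in_K[OF w assms(3)] i t0 by (auto simp: E_def intro!: mult_left_mono)
  finally have E: "norm (E x - E y) \<le> t * norm (E y)" .
  \<comment> \<open>The two factors of the chain rule are exchanged one at a time.\<close>
  have "D (i # w) x - D (i # w) y = ((E x - E y) o\<^sub>L D w x) + (E y o\<^sub>L (D w x - D w y))"
    using i w y assms by (intro blinfun_eqI) (simp add: D_Cons E_def blinfun.bilinear_simps)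
  then have "norm (D (i # w) x - D (i # w) y) \<le>
      norm (E x - E y) * norm (D w x) + norm (E y) * norm (D w x - D w y)"
    using order_trans[OF norm_triangle_ineq add_mono[OF norm_blinfun_compose norm_blinfun_compose]] by simp
  also have "\<dots> \<le> (t * norm (E y)) * (exp S * norm (D w y)) + norm (E y) * ((exp S - 1) * norm (D w y))"
    using E IH Dx t0 by (intro add_mono mult_mono) auto
  also have "\<dots> = (exp S * (1 + t) - 1) * (norm (E y) * norm (D w y))"
    by (simp add: algebra_simps)
  also have "\<dots> \<le> (exp (S + t) - 1) * (norm (E y) * norm (D w y))"
    using exp_ge_add_one_self[of t] by (intro mult_right_mono) (auto simp: exp_add)
  also have "norm (E y) * norm (D w y) = norm (D (i # w) y)"
    using norm_D_append[of "[i]" w y] i w y by (simp add: E_def word_map_single)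
  also have "S + t = c / m * r * (\<Sum>k<length (i # w). (lam powr \<alpha>) ^ k)"
    by (simp add: S_def t_def n_def algebra_simps)
  finally show ?case by (simp add: r_def)
qed

lemma distortion_exp:
  assumes "w \<in> words N" "x \<in> \<Omega>" "y \<in> K"
  shows "norm (D w x - D w y) \<le> (exp (Q * norm (x - y) powr \<alpha>) - 1) * norm (D w y)"
proof -
  have "(\<Sum>k<length w. (lam powr \<alpha>) ^ k) \<le> 1 / (1 - lam powr \<alpha>)"
    using theta by (simp add: sum_gp_strict divide_right_mono)
  then have "c / m * norm (x - y) powr \<alpha> * (\<Sum>k<length w. (lam powr \<alpha>) ^ k)
      \<le> c / m * norm (x - y) powr \<alpha> * (1 / (1 - lam powr \<alpha>))"
    using m hoelder(1,2) by (intro mult_left_mono) auto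
  also have "\<dots> = Q * norm (x - y) powr \<alpha>"
    by (simp add: Q_def)
  finally show ?thesis
    using order_trans[OF distortion_aux[OF assms] mult_right_mono] by simp
qed

lemma exp_le_C:
  assumes "x \<in> \<Omega>" "y \<in> \<Omega>"
  shows "exp (Q * norm (x - y) powr \<alpha>) \<le> exp (Q * R powr \<alpha>)"
  using assms R Q_pos hoelder(1,2) by (auto intro!: mult_left_mono powr_mono2)

lemma distortion:
  assumes "w \<in> words N" "x \<in> \<Omega>" "y \<in> K"
  shows "norm (D w x - D w y) \<le> C * norm (x - y) powr \<alpha> * norm (D w y)"
proof -
  define z where "z = Q * norm (x - y) powr \<alpha>"
  have z: "0 \<le> z"
    using Q_pos by (simp add: z_def)
  \<comment> \<open>This is \<open>exp (- z) \<ge> 1 - z\<close> multiplied by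
    \<open>exp z\<close>.\<close>
  have "exp z - 1 \<le> z * exp z"
    using mult_left_mono[OF exp_ge_add_one_self[of "- z"], of "exp z"]
    by (simp add: algebra_simps flip: exp_add)
  also have "\<dots> \<le> z * exp (Q * R powr \<alpha>)"
    unfolding z_def using z assms K(1) by (intro mult_left_mono exp_le_C) (auto simp: z_def)
  also have "\<dots> \<le> C * norm (x - y) powr \<alpha>"
    by (simp add: z_def C_def algebra_simps)
  finally show ?thesis
    using order_trans[OF distortion_exp[OF assms] mult_right_mono] by (simp add: z_def)
qed

lemma norm_D_le_C:
  assumes "w \<in> words N" "x \<in> \<Omega>" "y \<in> K"
  shows "norm (D w x) \<le> C * norm (D w y)"
proof -
  have "norm (D w x) \<le> exp (Q * norm (x - y) powr \<alpha>) * norm (D w y)"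
    using distortion_exp[OF assms] norm_triangle_ineq2[of "D w x" "D w y"]
    by (simp add: algebra_simps)
  also have "\<dots> \<le> C * norm (D w y)"
  proof (rule mult_right_mono)
    have "exp (Q * norm (x - y) powr \<alpha>) \<le> 1 * exp (Q * R powr \<alpha>)"
      using exp_le_C[of x y] assms K by auto
    also have "\<dots> \<le> C"
      unfolding C_def using Q_pos by (intro mult_right_mono) auto
    finally show "exp (Q * norm (x - y) powr \<alpha>) \<le> C" .
  qed simp
  finally show ?thesis .
qed

lemma nrm_le_C: "w \<in> words N \<Longrightarrow> y \<in> K \<Longrightarrow> nrm w \<le> C * norm (D w y)"
  by (intro nrm_le norm_D_le_C)

lemma distortion':
  assumes "w \<in> words N" "x \<in> \<Omega>" "y \<in> K"
  shows "norm (D w x - D w y) \<le> C * norm (x - y) powr \<alpha> * nrm w"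
  using order_trans[OF distortion[OF assms] mult_left_mono[OF norm_D_le_nrm]] assms K C_ge_1
  by auto

text \<open>At a point of \<open>K\<close> each of \<open>nrm u\<close> and \<open>nrm v\<close>
  exceeds its local value by a factor of at most \<open>C\<close>, and the local norms multiply
  exactly; hence \<open>C\<^sup>2\<close>.\<close>

lemma nrm_append_ge:
  assumes "u \<in> words N" "v \<in> words N"
  shows "nrm u * nrm v \<le> C\<^sup>2 * nrm (u @ v)"
proof -
  obtain y where y: "y \<in> K" "y \<in> \<Omega>"
    using K by auto
  have "nrm u * nrm v \<le> (C * norm (D u (W v y))) * (C * norm (D v y))"
    using nrm_le_C[OF assms(1) W_in_K[OF assms(2) y(1)]] nrm_le_C[OF assms(2) y(1)]
      nrm_pos[OF assms(1)] nrm_pos[OF assms(2)] by (intro mult_mono) auto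
  also have "\<dots> = C\<^sup>2 * norm (D (u @ v) y)"
    using assms y by (simp add: norm_D_append power2_eq_square)
  also have "\<dots> \<le> C\<^sup>2 * nrm (u @ v)"
    using assms y by (intro mult_left_mono norm_D_le_nrm) auto
  finally show ?thesis .
qed

text \<open>On the segment from \<open>p\<close> to \<open>q\<close> the differential stays within
  half of \<open>norm (D w p)\<close> of \<open>D w p\<close>. Subtracting this linear part leaves a
  map \<open>g\<close> whose variation cancels at most half of the stretching.\<close>

lemma lower_lipschitz:
  assumes "w \<in> words N" "p \<in> K" "q \<in> \<Omega>" "C * norm (p - q) powr \<alpha> \<le> 1 / 2"
  shows "norm (D w p) * norm (p - q) \<le> 2 * norm (W w p - W w q)"
proof -
  have p: "p \<in> \<Omega>"
    using K assms by auto
  have seg: "closed_segment p q \<subseteq> \<Omega>"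
    using p assms convex_\<Omega> closed_segment_subset by blast
  define g where "g x = W w x - D w p x" for x
  have "norm (g q - g p) \<le> (norm (D w p) / 2) * norm (q - p)"
  proof (rule differentiable_bound[of "closed_segment p q" g "\<lambda>x. blinfun_apply (D w x - D w p)"])
    fix x assume x: "x \<in> closed_segment p q"
    then have x\<Omega>: "x \<in> \<Omega>" using seg by blast
    have "(g has_derivative (\<lambda>h. D w x h - D w p h)) (at x)"
      unfolding g_def
      by (rule has_derivative_diff[OF W_has_derivative[OF assms(1) x\<Omega>]
          bounded_linear_imp_has_derivative[OF blinfun.bounded_linear_right]])
    then show "(g has_derivative blinfun_apply (D w x - D w p)) (at x within closed_segment p q)"
      by (auto simp: minus_blinfun.rep_eq intro: has_derivative_at_withinI)
    have "norm (D w x - D w p) \<le> C * norm (x - p) powr \<alpha> * norm (D w p)"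
      by (rule distortion[OF assms(1) x\<Omega> assms(2)])
    also have "\<dots> \<le> C * norm (p - q) powr \<alpha> * norm (D w p)"
      using x C_ge_1 hoelder(1,2) by (intro mult_right_mono mult_left_mono powr_mono2)
        (auto dest: segment_bound1 simp: norm_minus_commute)
    also have "\<dots> \<le> 1 / 2 * norm (D w p)"
      using assms(4) by (intro mult_right_mono) auto
    finally show "onorm (blinfun_apply (D w x - D w p)) \<le> norm (D w p) / 2"
      by (simp add: norm_blinfun.rep_eq)
  qed auto
  moreover have "g q - g p = (W w q - W w p) - D w p (q - p)"
    by (simp add: g_def blinfun.diff_right)
  moreover have "norm (D w p (q - p)) = norm (D w p) * norm (q - p)"
    by (intro similarity_norm_apply D_similarity assms p)
  moreover have "norm (D w p (q - p)) \<le> norm (W w q - W w p) + norm ((W w q - W w p) - D w p (q - p))"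
    using norm_triangle_ineq4[of "W w q - W w p" "(W w q - W w p) - D w p (q - p)"] by simp
  ultimately show ?thesis
    by (simp add: norm_minus_commute)
qed

lemma powr_small:
  assumes "0 < e"
  shows "\<exists>\<rho>>0. \<forall>t. 0 \<le> t \<longrightarrow> t \<le> \<rho> \<longrightarrow> C * t powr \<alpha> \<le> e"
proof (intro exI conjI allI impI)
  define \<rho> where "\<rho> = (e / C) powr (1 / \<alpha>)"
  have C: "0 < C" using C_ge_1 by simp
  show "0 < \<rho>" using assms C by (simp add: \<rho>_def)
  fix t assume t: "0 \<le> t" "t \<le> \<rho>"
  have "t powr \<alpha> \<le> \<rho> powr \<alpha>"
    using t hoelder(1) by (intro powr_mono2) auto
  also have "\<dots> = e / C"
    using assms C hoelder(1) by (simp add: \<rho>_def powr_powr)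
  finally show "C * t powr \<alpha> \<le> e"
    using C by (simp add: field_simps)
qed

lemma lam_power_small:
  assumes "0 < \<rho>"
  shows "\<exists>n. lam ^ n * R \<le> \<rho>"
proof -
  obtain n where "lam ^ n < \<rho> / R"
    using real_arch_pow_inv[of "\<rho> / R" lam] assms R lam by auto
  then show ?thesis
    using R by (intro exI[of _ n]) (simp add: field_simps)
qed

lemma W_diameter:
  assumes "w \<in> words N" "x \<in> \<Omega>" "y \<in> \<Omega>"
  shows "norm (W w x - W w y) \<le> nrm w * R"
  using order_trans[OF W_lipschitz[OF assms] mult_left_mono[OF R(2)]] assms nrm_pos[of w] by simp

text \<open>
  By compactness, the normalised differentials at \<open>z\<close> of two powers \<open>s\<^sup>a\<close> and \<open>s\<^sup>b\<close> with \<open>a < b\<close> nearly agree,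
  and cancelling the common left factor leaves the power \<open>s\<^bsup>b - a\<^esup>\<close>.
\<close>

lemma power_word_near_scalar:
  assumes s: "s \<in> words N" and z: "z \<in> K" and near: "\<And>x. x \<in> \<Omega> \<Longrightarrow> norm (W s x - z) \<le> \<rho>"
    and "0 < e"
  shows "\<exists>p. norm (D (concat (replicate (Suc p) s)) z
      - norm (D (concat (replicate (Suc p) s)) z) *\<^sub>R id_blinfun)
    \<le> (e + 2 * C * \<rho> powr \<alpha>) * norm (D (concat (replicate (Suc p) s)) z)"
proof -
  define P where "P n = concat (replicate n s)" for n
  define O' where "O' n = D (P n) z /\<^sub>R norm (D (P n) z)" for n
  have z\<Omega>: "z \<in> \<Omega>" using z K by auto
  have P: "P n \<in> words N" for n
    using s by (induction n) (auto simp: P_def)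
  have pos: "0 < norm (D (P n) x)" if "x \<in> \<Omega>" for n x
    using norm_D_pos[OF P that] .
  have "O' n \<in> cball 0 1" for n
    using pos[OF z\<Omega>, of n] by (simp add: O'_def)
  \<comment> \<open>The space of linear maps has finite dimension, so its unit ball is compact and a
    subsequence of normalised powers converges.\<close>
  then obtain l r where "strict_mono r" and "(O' \<circ> r) \<longlonglongrightarrow> l"
    using compact_cball[of "0 :: 'a \<Rightarrow>\<^sub>L 'a" 1] unfolding compact_def by meson
  then have r: "strict_mono r" and "Cauchy (O' \<circ> r)"
    using LIMSEQ_imp_Cauchy by blast+
  then obtain n0 where "\<forall>i\<ge>n0. \<forall>j\<ge>n0. norm (O' (r i) - O' (r j)) < e"
    using \<open>0 < e\<close> unfolding Cauchy_iff by auto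
  then have close: "norm (O' (r n0) - O' (r (Suc n0))) < e"
    by simp
  define a where "a = r n0"
  \<comment> \<open>Subtracting 1 makes the difference of the two exponents \<open>Suc p\<close>, so
    the power is never the empty word.\<close>
  define p where "p = r (Suc n0) - r n0 - 1"
  have ap: "r (Suc n0) = a + Suc p"
    using strict_monoD[OF r, of n0 "Suc n0"] by (simp add: a_def p_def)
  \<comment> \<open>The outer power of \<open>P a @ P (Suc p)\<close> is differentiated at
    \<open>y\<close> rather than at \<open>z\<close>. As \<open>P (Suc p)\<close> starts with
    \<open>s\<close>, the point \<open>y\<close> is within \<rho> of \<open>z\<close>.\<close>
  define y where "y = W (P (Suc p)) z"
  have y: "y \<in> \<Omega>" "norm (y - z) \<le> \<rho>"
    using near[OF W_in_\<Omega>[OF P z\<Omega>, of p]] W_in_\<Omega>[OF P z\<Omega>, of "Suc p"]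
    by (auto simp: y_def P_def word_map_append)
  define E E0 T where "E = D (P a) y" and "E0 = D (P a) z" and "T = D (P (Suc p)) z"
  have simE0: "similarity E0"
    unfolding E0_def using D_similarity[OF P z\<Omega>] .
  have E: "0 < norm E" and E0: "0 < norm E0" and T: "0 < norm T"
    using pos y z\<Omega> by (auto simp: E_def E0_def T_def)
  have "P (a + Suc p) = P a @ P (Suc p)"
    by (simp only: P_def replicate_add concat_append)
  then have "D (P (a + Suc p)) z = E o\<^sub>L T"
    using D_append[OF P P z\<Omega>] by (simp add: E_def T_def y_def)
  moreover have "norm (E o\<^sub>L T) = norm E * norm T"
    unfolding E_def by (intro similarity_norm_compose_left D_similarity P y)
  ultimately have Ob: "O' (a + Suc p) = (E /\<^sub>R norm E) o\<^sub>L (T /\<^sub>R norm T)"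
    by (intro blinfun_eqI) (simp add: O'_def blinfun.bilinear_simps)
  have Oa: "O' a = E0 /\<^sub>R norm E0"
    by (simp add: O'_def E0_def)
  define T' where "T' = T /\<^sub>R norm T"
  have T': "norm T' = 1"
    using T by (simp add: T'_def)
  \<comment> \<open>Composing on the left with the normalised similarity \<open>E0\<close> preserves
    norms, so the distance of \<open>T'\<close> from the identity can be read off after that
    composition.\<close>
  have "norm (T' - id_blinfun) = norm ((E0 /\<^sub>R norm E0) o\<^sub>L (T' - id_blinfun))"
  proof -
    have "norm ((E0 /\<^sub>R norm E0) o\<^sub>L (T' - id_blinfun)) = norm ((E0 o\<^sub>L (T' - id_blinfun)) /\<^sub>R norm E0)"
      by (intro arg_cong[where f = norm] blinfun_eqI) (simp add: blinfun.bilinear_simps scaleR_diff_right)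
    then show ?thesis
      using E0 by (simp add: similarity_norm_compose_left[OF simE0])
  qed
  \<comment> \<open>Replacing \<open>E\<close> by \<open>E0\<close> costs distortion; what remains
    compares the two nearby normalised powers.\<close>
  also have "(E0 /\<^sub>R norm E0) o\<^sub>L (T' - id_blinfun) =
      ((E0 /\<^sub>R norm E0 - E /\<^sub>R norm E) o\<^sub>L T') + (O' (a + Suc p) - O' a)"
    unfolding Ob Oa T'_def[symmetric] by (intro blinfun_eqI) (simp add: blinfun.bilinear_simps algebra_simps)
  also have "norm \<dots> \<le> norm (E0 /\<^sub>R norm E0 - E /\<^sub>R norm E) * norm T' + norm (O' (a + Suc p) - O' a)"
    by (rule order_trans[OF norm_triangle_ineq add_right_mono[OF norm_blinfun_compose]])
  also have "norm (E0 /\<^sub>R norm E0 - E /\<^sub>R norm E) \<le> 2 * norm (E0 - E) / norm E0"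
    using E E0 by (intro norm_diff_normalized_le) auto
  also have "norm (E0 - E) \<le> C * \<rho> powr \<alpha> * norm E0"
  proof -
    have "norm (E0 - E) \<le> C * norm (y - z) powr \<alpha> * norm E0"
      using distortion[OF P y(1) z, of a] by (simp add: E_def E0_def norm_minus_commute)
    also have "\<dots> \<le> C * \<rho> powr \<alpha> * norm E0"
      using y C_ge_1 hoelder(1) by (intro mult_right_mono mult_left_mono powr_mono2) auto
    finally show ?thesis .
  qed
  also have "norm (O' (a + Suc p) - O' a) \<le> e"
    using close ap by (simp add: a_def norm_minus_commute)
  finally have "norm (T' - id_blinfun) \<le> 2 * C * \<rho> powr \<alpha> + e"
    using T' E0 by (simp add: divide_right_mono mult_left_mono)
  then have "norm (T' - id_blinfun) * norm T \<le> (2 * C * \<rho> powr \<alpha> + e) * norm T"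
    by (intro mult_right_mono) auto
  moreover have "norm (T' - id_blinfun) * norm T = norm (T - norm T *\<^sub>R id_blinfun)"
  proof -
    have "T - norm T *\<^sub>R id_blinfun = norm T *\<^sub>R (T' - id_blinfun)"
      using T by (simp add: T'_def scaleR_diff_right)
    then show ?thesis by (simp add: mult.commute)
  qed
  ultimately show ?thesis
    unfolding T_def P_def by (intro exI[of _ p]) (simp add: algebra_simps)
qed

end

section \<open>Crosswise composition of close pairs\<close>

lemma blinfun_compose_mono:
  assumes "norm A \<le> a" "norm B \<le> b"
  shows "norm (A o\<^sub>L B) \<le> a * b"
  using assms by (intro order_trans[OF norm_blinfun_compose] mult_mono) (auto intro: order_trans[OF norm_ge_zero])

text \<open>
  If \<open>G X\<close> is close to the scalar \<open>t\<close> then so is \<open>X G\<close>, hence \<open>X G Y\<close> and \<open>Y G X\<close> are both close to \<open>t Y\<close>.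
\<close>

lemma swap_estimate:
  fixes P Q G G' X Y :: "'a::euclidean_space \<Rightarrow>\<^sub>L 'a" and a b g s t \<kappa> :: real
  assumes nonneg: "0 \<le> s" "0 \<le> t" "0 \<le> \<kappa>" "1 \<le> b"
    and P: "norm (P - s *\<^sub>R X) \<le> \<kappa> * (s * a)" and Q: "norm (Q - s *\<^sub>R Y) \<le> \<kappa> * (s * a)"
    and G: "norm G \<le> g" "norm G' \<le> g" "norm (G' - G) \<le> \<kappa> * g"
    and X: "norm X \<le> a" "similarity X" and Y: "norm Y \<le> b * a"
    and GX: "norm ((G o\<^sub>L X) - t *\<^sub>R id_blinfun) \<le> \<kappa> * t" "t \<le> g * a"
  shows "norm ((P o\<^sub>L G' o\<^sub>L Y) - (Q o\<^sub>L G o\<^sub>L X)) \<le> 5 * b * \<kappa> * (s * a * g * a)"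
proof -
  have a: "0 \<le> a" and g: "0 \<le> g"
    using X(1) G(1) norm_ge_zero order_trans by blast+
  \<comment> \<open>Moving \<open>X\<close> across turns \<open>(X G - t) X\<close> into
    \<open>X (G X - t)\<close>, and the similarity \<open>X\<close> contributes the same factor
    \<open>norm X\<close> on either side.\<close>
  have "norm ((X o\<^sub>L G) - t *\<^sub>R id_blinfun) * norm X =
      norm (X o\<^sub>L ((G o\<^sub>L X) - t *\<^sub>R id_blinfun))"
    unfolding similarity_norm_compose_right[OF X(2), symmetric]
    by (intro arg_cong[where f = norm] blinfun_eqI) (simp add: blinfun.bilinear_simps)
  also have "\<dots> = norm ((G o\<^sub>L X) - t *\<^sub>R id_blinfun) * norm X"
    by (simp add: similarity_norm_compose_left[OF X(2)])
  finally have XG: "norm ((X o\<^sub>L G) - t *\<^sub>R id_blinfun) \<le> \<kappa> * t"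
    using GX(1) similarity_norm_pos[OF X(2)] by simp
  \<comment> \<open>\<open>T1\<close>, \<open>T2\<close>, \<open>T3\<close> lead from
    \<open>P G' Y\<close> to \<open>s t Y\<close>; \<open>T5\<close>, \<open>T4\<close> lead from
    \<open>Q G X\<close> to the same operator.\<close>
  define T1 where "T1 = ((P - s *\<^sub>R X) o\<^sub>L (G' o\<^sub>L Y))"
  define T2 where "T2 = s *\<^sub>R (X o\<^sub>L ((G' - G) o\<^sub>L Y))"
  define T3 where "T3 = s *\<^sub>R (((X o\<^sub>L G) - t *\<^sub>R id_blinfun) o\<^sub>L Y)"
  define T4 where "T4 = s *\<^sub>R (Y o\<^sub>L ((G o\<^sub>L X) - t *\<^sub>R id_blinfun))"
  define T5 where "T5 = ((Q - s *\<^sub>R Y) o\<^sub>L (G o\<^sub>L X))"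
  have "(P o\<^sub>L G' o\<^sub>L Y) - (Q o\<^sub>L G o\<^sub>L X) = T1 + T2 + T3 - T4 - T5"
    unfolding T1_def T2_def T3_def T4_def T5_def
    by (intro blinfun_eqI) (simp add: blinfun.bilinear_simps algebra_simps)
  moreover have "norm (T1 + T2 + T3 - T4 - T5) \<le> norm T1 + norm T2 + norm T3 + norm T4 + norm T5"
    by (intro order_trans[OF norm_triangle_ineq4] add_right_mono order_trans[OF norm_triangle_ineq]
        add_mono norm_triangle_ineq order_refl)
  ultimately have "norm ((P o\<^sub>L G' o\<^sub>L Y) - (Q o\<^sub>L G o\<^sub>L X)) \<le>
      norm T1 + norm T2 + norm T3 + norm T4 + norm T5"
    by simp
  moreover have "norm T1 \<le> \<kappa> * (s * a) * (g * (b * a))"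
    unfolding T1_def by (intro blinfun_compose_mono P G Y)
  moreover have "norm T2 \<le> s * (a * (\<kappa> * g * (b * a)))"
    unfolding T2_def using nonneg by (simp add: mult_left_mono blinfun_compose_mono X G Y)
  moreover have "norm T3 \<le> s * (\<kappa> * t * (b * a))"
    unfolding T3_def using nonneg by (simp add: mult_left_mono blinfun_compose_mono XG Y)
  moreover have "norm T4 \<le> s * (b * a * (\<kappa> * t))"
    unfolding T4_def using nonneg by (simp add: mult_left_mono blinfun_compose_mono GX Y)
  moreover have "norm T5 \<le> \<kappa> * (s * a) * (g * a)"
    unfolding T5_def by (intro blinfun_compose_mono Q G X)
  moreover have "s * (\<kappa> * t * (b * a)) \<le> s * (\<kappa> * (g * a) * (b * a))"
    using nonneg a GX(2) by (intro mult_left_mono mult_right_mono) auto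
  moreover have "1 * (\<kappa> * (s * a) * (g * a)) \<le> b * (\<kappa> * (s * a) * (g * a))"
    using nonneg a g by (intro mult_right_mono) auto
  ultimately show ?thesis
    by (simp add: algebra_simps)
qed

locale conformal_attractor = conformal_system +
  fixes F :: "'a set"
  assumes F: "compact F" "F \<subseteq> K" "F = (\<Union>i\<in>{1..N}. \<phi> i ` F)"
    and two_points: "\<exists>x\<in>F. \<exists>y\<in>F. x \<noteq> y"
begin

section \<open>Coding of points of the attractor\<close>

lemma F_sub_\<Omega>: "x \<in> F \<Longrightarrow> x \<in> \<Omega>"
  using F K by auto

lemma F_sub_K: "x \<in> F \<Longrightarrow> x \<in> K"
  using F by auto

lemma W_in_F: "w \<in> words N \<Longrightarrow> x \<in> F \<Longrightarrow> W w x \<in> F"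
proof (induction w)
  case (Cons i w)
  then show ?case
    by (subst F(3)) (auto simp: word_map_Cons)
qed (simp add: word_map_Nil)

lemma coding:
  assumes "z \<in> F"
  shows "\<exists>w\<in>words N. length w = n \<and> z \<in> W w ` F"
proof (induction n)
  case 0
  then show ?case
    using assms by (intro bexI[of _ "[]"]) (auto simp: word_map_Nil)
next
  case (Suc n)
  then obtain w y where w: "w \<in> words N" "length w = n" "y \<in> F" "z = W w y"
    by auto
  then obtain i y' where "i \<in> {1..N}" "y' \<in> F" "y = \<phi> i y'"
    using F(3) by blast
  then show ?case
    using w by (intro bexI[of _ "w @ [i]"]) (auto simp: word_map_append word_map_single)
qed

lemma coding_near:
  assumes "z \<in> F" "0 < \<rho>"
  shows "\<exists>e\<in>words N. \<forall>x\<in>\<Omega>. norm (W e x - z) \<le> \<rho>"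
proof -
  obtain n where n: "lam ^ n * R \<le> \<rho>"
    using lam_power_small[OF assms(2)] by blast
  obtain e y where e: "e \<in> words N" "length e = n" "y \<in> F" "z = W e y"
    using coding[OF assms(1), of n] by auto
  have "norm (W e x - z) \<le> \<rho>" if "x \<in> \<Omega>" for x
  proof -
    have "norm (W e x - z) \<le> nrm e * R"
      using W_diameter[OF e(1) that F_sub_\<Omega>[OF e(3)]] e by simp
    also have "\<dots> \<le> lam ^ n * R"
      using nrm_le_power[OF e(1)] e R by (intro mult_right_mono) auto
    finally show ?thesis using n by simp
  qed
  then show ?thesis using e by blast
qed

text \<open>A coding word of least length with \<open>nrm w \<le> t\<close> has a parent that still
  codes \<open>z\<close> and violates the bound; the removed last letter costs at most the factor
  \<open>m / C\<^sup>2\<close>.\<close>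

lemma coding_at_scale:
  assumes "z \<in> F" "0 < t" "t < 1"
  shows "\<exists>w\<in>words N. z \<in> W w ` F \<and> nrm w \<le> t \<and> m / C\<^sup>2 * t \<le> nrm w"
proof -
  define A where "A n \<longleftrightarrow> (\<exists>w\<in>words N. length w = n \<and> z \<in> W w ` F \<and> nrm w \<le> t)" for n
  obtain n where "lam ^ n < t"
    using real_arch_pow_inv[of t lam] assms lam by auto
  then have ex: "A n"
    using coding[OF assms(1), of n] nrm_le_power unfolding A_def by (metis less_imp_le order_trans)
  define n0 where "n0 = (LEAST n. A n)"
  have "A n0"
    unfolding n0_def using ex by (rule LeastI)
  then obtain w y where w: "w \<in> words N" "length w = n0" "z = W w y" "y \<in> F" "nrm w \<le> t"
    unfolding A_def by auto
  \<comment> \<open>The identity has derivative norm at least 1, which exceeds \<open>t\<close>; so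
    there is a last letter to remove.\<close>
  have "w \<noteq> []"
  proof
    assume "w = []"
    then have "nrm w \<ge> 1"
      using norm_D_le_nrm[of "[]" y] D_Nil F_sub_\<Omega>[OF w(4)] by simp
    then show False using w assms by simp
  qed
  then obtain w' i where w': "w = w' @ [i]"
    by (cases w rule: rev_cases) auto
  then have words: "w' \<in> words N" "i \<in> {1..N}"
    using w by auto
  have "\<phi> i y \<in> F"
    using W_in_F[of "[i]" y] words w by (simp add: word_map_single)
  then have "z \<in> W w' ` F"
    using w w' by (auto simp: word_map_append word_map_single)
  moreover have "\<not> A (length w')"
    using w w' unfolding n0_def by (intro not_less_Least) auto
  ultimately have gt: "t < nrm w'"
    using words unfolding A_def by force
  have "m \<le> nrm [i]"
    using m(2)[OF words(2) F_sub_K[OF w(4)]] norm_D_le_nrm[of "[i]" y] words F_sub_\<Omega>[OF w(4)]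
    by (simp add: word_map_single)
  then have "t * m \<le> nrm w' * nrm [i]"
    using gt m(1) assms by (intro mult_mono) auto
  also have "\<dots> \<le> C\<^sup>2 * nrm w"
    unfolding w' using words by (intro nrm_append_ge) auto
  finally have "m / C\<^sup>2 * t \<le> nrm w"
    using C_ge_1 by (simp add: field_simps)
  then show ?thesis
    using w by blast
qed

text \<open>A word map with small image pulls two distinct points of \<open>F\<close> together, and
  injectivity keeps them apart.\<close>

lemma close_points:
  assumes "0 < \<rho>"
  shows "\<exists>x\<in>F. \<exists>y\<in>F. x \<noteq> y \<and> norm (x - y) \<le> \<rho>"
proof -
  obtain x y where xy: "x \<in> F" "y \<in> F" "x \<noteq> y"
    using two_points by auto
  obtain e where e: "e \<in> words N" "\<forall>x'\<in>\<Omega>. norm (W e x' - x) \<le> \<rho> / 2"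
    using coding_near[OF xy(1), of "\<rho> / 2"] assms by auto
  have "norm (W e x - W e y) \<le> \<rho>"
  proof -
    have "norm (W e x - x) \<le> \<rho> / 2" "norm (W e y - x) \<le> \<rho> / 2"
      using e(2) F_sub_\<Omega> xy by auto
    then show ?thesis by norm
  qed
  moreover have "W e x \<noteq> W e y"
    using inj_onD[OF inj_on_W[OF e(1)]] xy F_sub_\<Omega> by blast
  ultimately show ?thesis
    using W_in_F[OF e(1)] xy by blast
qed

text \<open>Two fixed nearby points \<open>x\<close>, \<open>y\<close> of \<open>F\<close> measure
  every norm: \<open>norm (W w x - W w y)\<close> equals \<open>nrm w * d\<close> up to the factor
  \<open>2 * C\<close>. Closeness of two word maps at these points then carries over to their
  norms.\<close>

lemma nrm_comparable:
  "\<exists>\<eta>>0. \<forall>u\<in>words N. \<forall>v\<in>words N. (\<forall>x\<in>F. norm (W u x - W v x) \<le> \<eta> * nrm u) \<longrightarrow>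
    nrm v \<le> 4 * C * nrm u \<and> nrm u \<le> 4 * C * nrm v"
proof -
  obtain \<rho> where \<rho>: "0 < \<rho>" "\<And>t. 0 \<le> t \<Longrightarrow> t \<le> \<rho> \<Longrightarrow> C * t powr \<alpha> \<le> 1 / 2"
    using powr_small[of "1 / 2"] by auto
  obtain x y where xy: "x \<in> F" "y \<in> F" "x \<noteq> y" "norm (x - y) \<le> \<rho>"
    using close_points[OF \<rho>(1)] by auto
  define d where "d = norm (x - y)"
  have d: "0 < d"
    using xy by (simp add: d_def)
  have C: "0 < C" "1 \<le> C"
    using C_ge_1 by auto
  have lower: "nrm w * d \<le> 2 * C * norm (W w x - W w y)" if w: "w \<in> words N" for w
  proof -
    have "norm (D w x) * d \<le> 2 * norm (W w x - W w y)"
      unfolding d_def using \<rho>(2)[of "norm (x - y)"] xy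
      by (intro lower_lipschitz w F_sub_K F_sub_\<Omega>) auto
    then have "C * (norm (D w x) * d) \<le> C * (2 * norm (W w x - W w y))"
      using C by (intro mult_left_mono) auto
    moreover have "nrm w * d \<le> C * norm (D w x) * d"
      using d by (intro mult_right_mono nrm_le_C w F_sub_K xy) auto
    ultimately show ?thesis by (simp add: algebra_simps)
  qed
  have upper: "norm (W w x - W w y) \<le> nrm w * d" if w: "w \<in> words N" for w
    unfolding d_def by (intro W_lipschitz w F_sub_\<Omega> xy)
  show ?thesis
  \<comment> \<open>With this threshold the error \<open>2 * h\<close>, multiplied by
    \<open>2 * C\<close>, is \<open>nrm u * d / 2\<close>, which the left-hand side absorbs in the
    second comparison.\<close>
  proof (intro exI[of _ "d / (8 * C)"] conjI ballI impI)
    show "0 < d / (8 * C)"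
      using d C by simp
    fix u v assume u: "u \<in> words N" and v: "v \<in> words N"
      and close: "\<forall>x\<in>F. norm (W u x - W v x) \<le> d / (8 * C) * nrm u"
    define h where "h = d / (8 * C) * nrm u"
    have hx: "norm (W u x - W v x) \<le> h" and hy: "norm (W u y - W v y) \<le> h"
      using close xy by (auto simp: h_def)
    have uv: "norm (W v x - W v y) \<le> norm (W u x - W u y) + 2 * h"
      "norm (W u x - W u y) \<le> norm (W v x - W v y) + 2 * h"
      using hx hy by norm+
    have "nrm v * d \<le> 2 * C * (nrm u * d + 2 * h)"
      using order_trans[OF lower[OF v] mult_left_mono[of _ "nrm u * d + 2 * h" "2 * C"]]
        uv(1) upper[OF u] C by auto
    also have "\<dots> = (2 * C + 1 / 2) * nrm u * d"
      using C by (simp add: h_def field_simps)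
    also have "\<dots> \<le> (4 * C) * nrm u * d"
      using C d nrm_pos[OF u] by (intro mult_right_mono) auto
    finally show "nrm v \<le> 4 * C * nrm u"
      using d by simp
    have "nrm u * d \<le> 2 * C * (nrm v * d + 2 * h)"
      using order_trans[OF lower[OF u] mult_left_mono[of _ "nrm v * d + 2 * h" "2 * C"]]
        uv(2) upper[OF v] C by auto
    also have "\<dots> = 2 * C * (nrm v * d) + nrm u * d / 2"
      using C by (simp add: h_def field_simps)
    finally have "nrm u * d \<le> 4 * C * nrm v * d"
      by (simp add: algebra_simps)
    then show "nrm u \<le> 4 * C * nrm v"
      using d by simp
  qed
qed

text \<open>The value difference splits at \<open>W (u @ k) (W a z)\<close>. Moving from
  \<open>W b z\<close> to \<open>W a z\<close> under \<open>u @ k\<close> contributes an amount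
  comparable to \<open>nrm u * nrm k * norm (W a z - W b z)\<close>; exchanging \<open>u\<close> for
  \<open>v\<close> contributes at most \<open>\<eta>' * nrm u\<close>, too little to cancel it. The
  differentials are compared at \<open>z0\<close>, where \<open>types\<close> and
  \<open>scalar\<close> hold, and transported to \<open>z\<close> by distortion.\<close>

lemma swapped_words_close:
  assumes words: "a \<in> words N" "b \<in> words N" "k \<in> words N" "u \<in> words N" "v \<in> words N"
    and z: "z \<in> F" "z0 \<in> F" "C * norm (z - z0) powr \<alpha> \<le> \<kappa>"
    and B: "1 \<le> B" "nrm b \<le> B * nrm a" "nrm a \<le> B * nrm b" "nrm v \<le> B * nrm u"
    and ab: "\<And>x. x \<in> F \<Longrightarrow> norm (W a x - W b x) \<le> \<eta> * nrm a" "C * \<eta> powr \<alpha> \<le> min \<kappa> (1 / 2)"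
      "W a z \<noteq> W b z" "0 < \<eta>"
    and uv: "\<And>x. x \<in> F \<Longrightarrow> norm (W u x - W v x) \<le> \<eta>' * nrm u"
      "\<eta>' \<le> \<eta> * nrm k * nrm a" "2 * C ^ 3 * \<eta>' < nrm k * norm (W a z - W b z)"
    and near: "\<And>x. x \<in> \<Omega> \<Longrightarrow> norm (W k x - z0) \<le> \<rho>" "2 * B * C * \<rho> powr \<alpha> \<le> \<kappa>"
    and types: "norm (D u z0 /\<^sub>R nrm u - D a z0 /\<^sub>R nrm a) \<le> \<kappa> / 2"
      "norm (D v z0 /\<^sub>R nrm u - D b z0 /\<^sub>R nrm a) \<le> \<kappa> / 2"
    and scalar: "norm (D (k @ a) z0 - norm (D (k @ a) z0) *\<^sub>R id_blinfun) \<le> \<kappa> * norm (D (k @ a) z0)"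
  defines "p \<equiv> u @ k @ b" and "q \<equiv> v @ k @ a"
  shows "W p z \<noteq> W q z"
    and "norm (W p z - W q z) \<le> 2 * B * C ^ 4 * \<eta> * nrm p"
    and "norm (D p z - D q z) \<le> 7 * B\<^sup>2 * C ^ 4 * \<kappa> * nrm p"
proof -
  define U g A where "U = nrm u" and "g = nrm k" and "A = nrm a"
  have pos: "0 < U" "0 < g" "0 < A"
    using words nrm_pos by (auto simp: U_def g_def A_def)
  have C: "0 < C" "1 \<le> C"
    using C_ge_1 by auto
  have \<kappa>: "0 \<le> \<kappa>"
    using z(3) C by (meson mult_nonneg_nonneg less_imp_le order_trans powr_ge_zero)
  have p_words: "p \<in> words N" and q_words: "q \<in> words N"
    using words by (auto simp: p_def q_def)
  have z\<Omega>: "z \<in> \<Omega>" "z0 \<in> \<Omega>" and zK: "z \<in> K" "z0 \<in> K"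
    using z F_sub_\<Omega> F_sub_K by auto
  have nrm_p: "U * g * A \<le> B * C ^ 4 * nrm p"
  proof -
    have "U * g * A \<le> (C\<^sup>2 * nrm (u @ k)) * (B * nrm b)"
      using nrm_append_ge[of u k] words B(3) pos C nrm_pos[of "u @ k"]
      by (intro mult_mono[of "U * g"]) (auto simp: U_def g_def A_def)
    also have "\<dots> = B * C\<^sup>2 * (nrm (u @ k) * nrm b)"
      by simp
    also have "\<dots> \<le> B * C\<^sup>2 * (C\<^sup>2 * nrm p)"
      using nrm_append_ge[of "u @ k" b] words B(1) by (intro mult_left_mono) (auto simp: p_def)
    finally show ?thesis by (simp add: power2_eq_square power4_eq_xxxx algebra_simps)
  qed
  have nrm_q: "nrm q \<le> B * (U * g * A)"
  proof -
    have "nrm q \<le> nrm v * (nrm k * nrm a)"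
      unfolding q_def using words nrm_pos[of v]
      by (intro order_trans[OF nrm_append_le mult_left_mono[OF nrm_append_le]]) auto
    also have "\<dots> \<le> (B * U) * (nrm k * nrm a)"
      using B pos by (intro mult_right_mono) (auto simp: U_def g_def A_def)
    finally show ?thesis by (simp add: g_def A_def mult_ac)
  qed
  have nrm_p': "nrm p \<le> B * (U * g * A)"
  proof -
    have "nrm p \<le> nrm u * (nrm k * nrm b)"
      unfolding p_def using words nrm_pos[of u]
      by (intro order_trans[OF nrm_append_le mult_left_mono[OF nrm_append_le]]) auto
    also have "\<dots> \<le> U * (nrm k * (B * A))"
      using B pos less_imp_le[OF nrm_pos[OF words(2)]]
      by (intro mult_mono mult_left_mono) (auto simp: U_def g_def A_def)
    finally show ?thesis by (simp add: g_def mult_ac)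
  qed
  define x y where "x = W b z" and "y = W a z"
  define d where "d = norm (x - y)"
  have xy: "x \<in> F" "y \<in> F"
    using W_in_F words z by (auto simp: x_def y_def)
  have d: "0 < d" "d \<le> \<eta> * A"
    using ab(1)[OF z(1)] ab(3) by (auto simp: d_def x_def y_def A_def norm_minus_commute)
  have "\<eta> * A \<le> \<eta>"
    using nrm_le_1[OF words(1)] ab(4) pos by (simp add: A_def)
  then have d\<eta>: "d \<le> \<eta>"
    using d by simp
  have half: "C * norm (x - y) powr \<alpha> \<le> 1 / 2"
  proof -
    have "C * norm (x - y) powr \<alpha> \<le> C * \<eta> powr \<alpha>"
      using d\<eta> C hoelder(1) by (intro mult_left_mono powr_mono2) (auto simp: d_def)
    then show ?thesis using ab(2) by simp
  qed
  have p_z: "W p z = W (u @ k) x" and q_z: "W q z = W v (W k y)"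
    by (simp_all add: p_def q_def x_def y_def word_map_append)
  have ky: "W k y \<in> F"
    using W_in_F words xy by auto
  have uk: "u @ k \<in> words N"
    using words by auto
  have uv_ky: "norm (W (u @ k) y - W q z) \<le> \<eta>' * U"
    using uv(1)[OF ky] by (simp add: q_z word_map_append U_def)
  have "U * g * d \<le> 2 * C ^ 3 * norm (W (u @ k) x - W (u @ k) y)"
  proof -
    have "U * g * d \<le> C\<^sup>2 * nrm (u @ k) * d"
      using nrm_append_ge[of u k] words d by (intro mult_right_mono) (auto simp: U_def g_def)
    also have "\<dots> \<le> C\<^sup>2 * (C * norm (D (u @ k) x)) * d"
      using nrm_le_C[OF uk F_sub_K[OF xy(1)]] d C by (intro mult_right_mono mult_left_mono) auto
    also have "\<dots> = C ^ 3 * (norm (D (u @ k) x) * d)"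
      by (simp add: power2_eq_square power3_eq_cube)
    also have "\<dots> \<le> C ^ 3 * (2 * norm (W (u @ k) x - W (u @ k) y))"
      using lower_lipschitz[OF uk F_sub_K[OF xy(1)] F_sub_\<Omega>[OF xy(2)] half] C
      by (intro mult_left_mono) (auto simp: d_def)
    finally show ?thesis by simp
  qed
  moreover have "2 * C ^ 3 * (\<eta>' * U) < U * g * d"
    using uv(3) pos by (simp add: d_def x_def y_def g_def norm_minus_commute mult_ac)
  ultimately have "2 * C ^ 3 * (\<eta>' * U) < 2 * C ^ 3 * norm (W (u @ k) x - W (u @ k) y)"
    by linarith
  then have "\<eta>' * U < norm (W (u @ k) x - W (u @ k) y)"
    using C by simp
  then show "W p z \<noteq> W q z"
    using uv_ky by (auto simp: p_z norm_minus_commute)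
  have "norm (W (u @ k) x - W (u @ k) y) \<le> nrm (u @ k) * d"
    unfolding d_def by (intro W_lipschitz uk F_sub_\<Omega> xy)
  also have "\<dots> \<le> (U * g) * (\<eta> * A)"
    using nrm_append_le[of u k] words d pos by (intro mult_mono) (auto simp: U_def g_def)
  finally have "norm (W (u @ k) x - W (u @ k) y) \<le> \<eta> * (U * g * A)"
    by (simp add: mult_ac)
  moreover have "\<eta>' * U \<le> (\<eta> * g * A) * U"
    using uv(2) pos by (intro mult_right_mono) (auto simp: g_def A_def)
  moreover have "norm (W p z - W q z) \<le> norm (W (u @ k) x - W (u @ k) y) + norm (W (u @ k) y - W q z)"
    unfolding p_z by norm
  ultimately have "norm (W p z - W q z) \<le> 2 * \<eta> * (U * g * A)"
    using uv_ky by (simp add: mult_ac)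
  also have "\<dots> \<le> 2 * \<eta> * (B * C ^ 4 * nrm p)"
    using nrm_p ab(4) by (intro mult_left_mono) auto
  finally show "norm (W p z - W q z) \<le> 2 * B * C ^ 4 * \<eta> * nrm p"
    by (simp add: mult_ac)

  have \<rho>0: "C * \<rho> powr \<alpha> \<le> B * (C * \<rho> powr \<alpha>)"
    using mult_right_mono[OF B(1), of "C * \<rho> powr \<alpha>"] C by simp
  have near_u: "norm (D u (W k x') - D u z0) \<le> \<kappa> / 2 * U" if "x' \<in> \<Omega>" for x'
  proof -
    have "norm (D u (W k x') - D u z0) \<le> C * norm (W k x' - z0) powr \<alpha> * U"
      unfolding U_def by (intro distortion' words W_in_\<Omega> that zK)
    also have "\<dots> \<le> C * \<rho> powr \<alpha> * U"
      using near(1)[OF that] C hoelder(1) pos by (intro mult_right_mono mult_left_mono powr_mono2) auto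
    also have "\<dots> \<le> \<kappa> / 2 * U"
      using \<rho>0 near(2) pos by (intro mult_right_mono) auto
    finally show ?thesis .
  qed
  \<comment> \<open>Here \<open>nrm v\<close> may exceed \<open>U\<close> by the factor
    \<open>B\<close>; this is why \<open>near\<close> carries \<open>B\<close>.\<close>
  have near_v: "norm (D v (W k x') - D v z0) \<le> \<kappa> / 2 * U" if "x' \<in> \<Omega>" for x'
  proof -
    have "norm (D v (W k x') - D v z0) \<le> C * norm (W k x' - z0) powr \<alpha> * nrm v"
      by (intro distortion' words W_in_\<Omega> that zK)
    also have "\<dots> \<le> C * \<rho> powr \<alpha> * (B * U)"
      using near(1)[OF that] C hoelder(1) pos B nrm_pos[of v] words
      by (intro mult_mono mult_left_mono powr_mono2) (auto simp: U_def)
    also have "\<dots> \<le> \<kappa> / 2 * U"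
      using near(2) pos by (simp add: mult_ac)
    finally show ?thesis .
  qed
  \<comment> \<open>The ratio of scales: nearly equal types mean that \<open>D u z0\<close> is close
    to \<open>s *\<^sub>R D a z0\<close> and \<open>D v z0\<close> to
    \<open>s *\<^sub>R D b z0\<close>, with the same \<open>s\<close>.\<close>
  define s where "s = U / A"
  have sA: "s * A = U" and s0: "0 \<le> s"
    using pos by (auto simp: s_def)
  have scale: "norm (X - s *\<^sub>R Y) = U * norm (X /\<^sub>R U - Y /\<^sub>R A)" for X Y :: "'a \<Rightarrow>\<^sub>L 'a"
  proof -
    have "X - s *\<^sub>R Y = U *\<^sub>R (X /\<^sub>R U - Y /\<^sub>R A)"
      using pos by (simp add: s_def scaleR_diff_right divide_inverse)
    then show ?thesis using pos by simp
  qed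
  define z1 z2 where "z1 = W b z0" and "z2 = W a z0"
  have z12: "z1 \<in> F" "z2 \<in> F"
    using W_in_F words z by (auto simp: z1_def z2_def)
  \<comment> \<open>Chain-rule factors at \<open>z0\<close>. The filler is differentiated at
    \<open>z1\<close> for \<open>p\<close> and at \<open>z2\<close> for \<open>q\<close>, which
    yields \<open>G'\<close> and \<open>G\<close>.\<close>
  define P Q G G' X Y where "P = D u (W k z1)" and "Q = D v (W k z2)" and "G = D k z2"
    and "G' = D k z1" and "X = D a z0" and "Y = D b z0"
  have "D p z0 = P o\<^sub>L G' o\<^sub>L Y"
    using words z\<Omega> W_in_\<Omega> unfolding p_def P_def G'_def Y_def z1_def
    by (intro blinfun_eqI) (simp add: D_append word_map_append_apply)
  moreover have "D q z0 = Q o\<^sub>L G o\<^sub>L X"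
    using words z\<Omega> W_in_\<Omega> unfolding q_def Q_def G_def X_def z2_def
    by (intro blinfun_eqI) (simp add: D_append word_map_append_apply)
  moreover have "norm ((P o\<^sub>L G' o\<^sub>L Y) - (Q o\<^sub>L G o\<^sub>L X)) \<le> 5 * B * \<kappa> * (s * A * g * A)"
  proof (rule swap_estimate)
    have "norm (P - s *\<^sub>R X) \<le> norm (P - D u z0) + norm (D u z0 - s *\<^sub>R X)"
      using norm_triangle_ineq[of "P - D u z0" "D u z0 - s *\<^sub>R X"] by simp
    moreover have "norm (D u z0 - s *\<^sub>R X) \<le> U * (\<kappa> / 2)"
      unfolding scale X_def using types(1) pos by (intro mult_left_mono) (auto simp: U_def A_def)
    ultimately show "norm (P - s *\<^sub>R X) \<le> \<kappa> * (s * A)"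
      using near_u[OF F_sub_\<Omega>[OF z12(1)]] unfolding sA P_def by (simp add: mult_ac)
    have "norm (Q - s *\<^sub>R Y) \<le> norm (Q - D v z0) + norm (D v z0 - s *\<^sub>R Y)"
      using norm_triangle_ineq[of "Q - D v z0" "D v z0 - s *\<^sub>R Y"] by simp
    moreover have "norm (D v z0 - s *\<^sub>R Y) \<le> U * (\<kappa> / 2)"
      unfolding scale Y_def using types(2) pos by (intro mult_left_mono) (auto simp: U_def A_def)
    ultimately show "norm (Q - s *\<^sub>R Y) \<le> \<kappa> * (s * A)"
      using near_v[OF F_sub_\<Omega>[OF z12(2)]] unfolding sA Q_def by (simp add: mult_ac)
    show "norm G \<le> g" "norm G' \<le> g" "norm X \<le> A"
      unfolding G_def G'_def X_def g_def A_def
      by (intro norm_D_le_nrm words F_sub_\<Omega> z12 z\<Omega>)+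
    have "norm Y \<le> nrm b"
      unfolding Y_def by (intro norm_D_le_nrm words z\<Omega>)
    then show "norm Y \<le> B * A"
      using B(2) by (simp add: A_def)
    have "norm (z1 - z2) \<le> \<eta>"
      using ab(1)[OF z(2)] \<open>\<eta> * A \<le> \<eta>\<close> by (simp add: z1_def z2_def A_def norm_minus_commute)
    then have "C * norm (z1 - z2) powr \<alpha> \<le> C * \<eta> powr \<alpha>"
      using C hoelder(1) by (intro mult_left_mono powr_mono2) auto
    also have "\<dots> \<le> \<kappa>"
      using ab(2) by simp
    finally have "C * norm (z1 - z2) powr \<alpha> * g \<le> \<kappa> * g"
      using pos by (intro mult_right_mono) auto
    then show "norm (G' - G) \<le> \<kappa> * g"
      using distortion'[OF words(3) F_sub_\<Omega>[OF z12(1)] F_sub_K[OF z12(2)]]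
      by (simp add: G_def G'_def g_def)
    show "similarity X"
      unfolding X_def by (intro D_similarity words z\<Omega>)
    have GX: "D (k @ a) z0 = G o\<^sub>L X"
      unfolding G_def X_def z2_def by (intro D_append words z\<Omega>)
    show "norm ((G o\<^sub>L X) - norm (D (k @ a) z0) *\<^sub>R id_blinfun) \<le> \<kappa> * norm (D (k @ a) z0)"
      using scalar by (simp only: GX)
    show "norm (D (k @ a) z0) \<le> g * A"
      unfolding GX by (intro blinfun_compose_mono) fact+
  qed (use s0 \<kappa> B in auto)
  moreover have "norm (D p z - D p z0) \<le> \<kappa> * (B * (U * g * A))"
    by (rule order_trans[OF distortion'[OF p_words z\<Omega>(1) zK(2)]])
      (use z(3) nrm_p' nrm_pos[OF p_words] \<kappa> in \<open>intro mult_mono; simp\<close>)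
  moreover have "norm (D q z - D q z0) \<le> \<kappa> * (B * (U * g * A))"
    by (rule order_trans[OF distortion'[OF q_words z\<Omega>(1) zK(2)]])
      (use z(3) nrm_q nrm_pos[OF q_words] \<kappa> in \<open>intro mult_mono; simp\<close>)
  moreover have "norm (D p z - D q z) \<le>
      norm (D p z - D p z0) + norm (D p z0 - D q z0) + norm (D q z - D q z0)"
    by norm
  \<comment> \<open>Five units from the swap and one for each of the two changes of base point add
    up to 7.\<close>
  ultimately have "norm (D p z - D q z) \<le> 7 * B * \<kappa> * (U * g * A)"
    unfolding sA by (simp add: algebra_simps)
  also have "\<dots> \<le> 7 * B * \<kappa> * (B * C ^ 4 * nrm p)"
    using nrm_p B \<kappa> by (intro mult_left_mono) auto
  finally show "norm (D p z - D q z) \<le> 7 * B\<^sup>2 * C ^ 4 * \<kappa> * nrm p"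
    by (simp add: power2_eq_square mult_ac)
qed

text \<open>The order of choices carries the argument: first a limit type by compactness, then the
  pair \<open>(a, b)\<close>, then the filler \<open>k\<close>, and last a pair
  \<open>(u i, v i)\<close> of nearly the same type whose closeness is fine compared with all of
  these.\<close>

lemma near_tangent_pair:
  assumes pairs: "\<And>\<eta>. 0 < \<eta> \<Longrightarrow> \<exists>u\<in>words N. \<exists>v\<in>words N. \<exists>z\<in>F. W u z \<noteq> W v z \<and>
      (\<forall>x\<in>F. norm (W u x - W v x) \<le> \<eta> * nrm u)"
    and \<tau>: "0 < \<tau>"
  shows "\<exists>p\<in>words N. \<exists>q\<in>words N. \<exists>z\<in>F. W p z \<noteq> W q z \<and>
    norm (W p z - W q z) \<le> \<tau> * nrm p \<and> norm (D p z - D q z) \<le> \<tau> * nrm p"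
proof -
  have C: "0 < C" "1 \<le> C"
    using C_ge_1 by auto
  define B where "B = 4 * C"
  have B: "1 \<le> B" "2 \<le> B" "0 < B"
    using C by (auto simp: B_def)
  obtain \<eta>0 where \<eta>0: "0 < \<eta>0" and comparable: "\<And>u v. u \<in> words N \<Longrightarrow> v \<in> words N \<Longrightarrow>
      (\<forall>x\<in>F. norm (W u x - W v x) \<le> \<eta>0 * nrm u) \<Longrightarrow> nrm v \<le> B * nrm u \<and> nrm u \<le> B * nrm v"
    using nrm_comparable unfolding B_def by blast
  \<comment> \<open>Tolerances that start at \<open>\<eta>0\<close> make every pair comparable in
    norm.\<close>
  define good where "good n u v z \<longleftrightarrow> u \<in> words N \<and> v \<in> words N \<and> z \<in> F \<and> W u z \<noteq> W v z \<and>
      (\<forall>x\<in>F. norm (W u x - W v x) \<le> \<eta>0 / Suc n * nrm u)" for n u v z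
  have "\<exists>u v z. good n u v z" for n
    using pairs[of "\<eta>0 / Suc n"] \<eta>0 unfolding good_def by (auto simp: Bex_def)
  then obtain u0 v0 zz where good0: "\<And>n. good n (u0 n) (v0 n) (zz n)"
    by metis
  have nrm0: "nrm (v0 n) \<le> B * nrm (u0 n) \<and> nrm (u0 n) \<le> B * nrm (v0 n)" for n
  proof (rule comparable)
    have "\<eta>0 / Suc n * nrm (u0 n) \<le> \<eta>0 * nrm (u0 n)"
      using \<eta>0 good0[of n] nrm_pos[of "u0 n"]
      by (intro mult_right_mono) (auto simp: good_def divide_le_eq)
    then show "\<forall>x\<in>F. norm (W (u0 n) x - W (v0 n) x) \<le> \<eta>0 * nrm (u0 n)"
      using good0[of n] unfolding good_def by (meson order_trans)
  qed (use good0[of n] in \<open>auto simp: good_def\<close>)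
  have "\<forall>n. zz n \<in> F"
    using good0 by (auto simp: good_def)
  then obtain z0 r1 where z0: "z0 \<in> F" and r1: "strict_mono r1" and "(zz \<circ> r1) \<longlonglongrightarrow> z0"
    using F(1) unfolding compact_def by meson
  \<comment> \<open>The type of a pair. Both differentials are divided by \<open>nrm (u0 n)\<close>,
    so one scale factor relates two pairs of equal type; comparability keeps the second component in
    the ball of radius \<open>B\<close>.\<close>
  define T where "T n = (D (u0 n) z0 /\<^sub>R nrm (u0 n), D (v0 n) z0 /\<^sub>R nrm (u0 n))" for n
  have T: "(T \<circ> r1) n \<in> cball 0 1 \<times> cball 0 B" for n
  proof -
    define k where "k = r1 n"
    have words: "u0 k \<in> words N" "v0 k \<in> words N"
      using good0[of k] by (auto simp: good_def)
    have "norm (D (u0 k) z0) \<le> nrm (u0 k)" "norm (D (v0 k) z0) \<le> B * nrm (u0 k)"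
      using norm_D_le_nrm[OF words(1) F_sub_\<Omega>[OF z0]] norm_D_le_nrm[OF words(2) F_sub_\<Omega>[OF z0]] nrm0[of k]
      by auto
    then show ?thesis
      using nrm_pos[OF words(1)] by (simp add: T_def k_def field_simps)
  qed
  have "compact (cball (0 :: 'a \<Rightarrow>\<^sub>L 'a) 1 \<times> cball (0 :: 'a \<Rightarrow>\<^sub>L 'a) B)"
    by (intro compact_Times compact_cball)
  then obtain l r2 where r2: "strict_mono r2" and "((T \<circ> r1) \<circ> r2) \<longlonglongrightarrow> l"
    using T unfolding compact_def by meson
  then have cauchy: "Cauchy ((T \<circ> r1) \<circ> r2)"
    using LIMSEQ_imp_Cauchy by blast
  define u v z where "u n = u0 (r1 (r2 n))" and "v n = v0 (r1 (r2 n))" and "z n = zz (r1 (r2 n))" for n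
  have z_lim: "z \<longlonglongrightarrow> z0"
    using LIMSEQ_subseq_LIMSEQ[OF \<open>(zz \<circ> r1) \<longlonglongrightarrow> z0\<close> r2] by (simp add: z_def[abs_def] o_def)
  have words: "u n \<in> words N" "v n \<in> words N" and zF: "z n \<in> F" and ne: "W (u n) (z n) \<noteq> W (v n) (z n)" for n
    using good0 by (auto simp: good_def u_def v_def z_def)
  have close: "norm (W (u n) x - W (v n) x) \<le> \<eta>0 / Suc n * nrm (u n)" if "x \<in> F" for n x
  proof -
    define k where "k = r1 (r2 n)"
    have "n \<le> k"
      using seq_suble[OF r1, of "r2 n"] seq_suble[OF r2, of n] by (simp add: k_def)
    then have "\<eta>0 / Suc k * nrm (u n) \<le> \<eta>0 / Suc n * nrm (u n)"
      using \<eta>0 less_imp_le[OF nrm_pos[OF words(1)]]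
      by (intro mult_right_mono divide_left_mono) auto
    moreover have "norm (W (u n) x - W (v n) x) \<le> \<eta>0 / Suc k * nrm (u n)"
      using good0[of k] that by (auto simp: good_def u_def v_def k_def)
    ultimately show ?thesis by simp
  qed
  have nrm_uv: "nrm (v n) \<le> B * nrm (u n)" "nrm (u n) \<le> B * nrm (v n)" for n
    using nrm0 by (auto simp: u_def v_def)
  have small: "\<exists>n0. \<forall>n\<ge>n0. \<eta>0 / Suc n \<le> e" if "0 < e" for e
  proof -
    have "(\<lambda>n. \<eta>0 / Suc n) \<longlonglongrightarrow> 0"
      using LIMSEQ_Suc[OF lim_const_over_n[of \<eta>0]] by simp
    then have "eventually (\<lambda>n. \<eta>0 / Suc n < e) sequentially"
      using that by (intro order_tendstoD)
    then show ?thesis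
      unfolding eventually_sequentially by (meson less_imp_le)
  qed

  \<comment> \<open>Turns the differential bound of \<open>swapped_words_close\<close> into exactly
    \<tau>.\<close>
  define \<kappa> where "\<kappa> = \<tau> / (7 * B\<^sup>2 * C ^ 4)"
  have \<kappa>: "0 < \<kappa>"
    using \<tau> B C by (simp add: \<kappa>_def)
  obtain \<rho>1 where \<rho>1: "0 < \<rho>1" "\<And>t. 0 \<le> t \<Longrightarrow> t \<le> \<rho>1 \<Longrightarrow> C * t powr \<alpha> \<le> \<kappa>"
    using powr_small[OF \<kappa>] by auto
  obtain \<rho>2 where \<rho>2: "0 < \<rho>2" "\<And>t. 0 \<le> t \<Longrightarrow> t \<le> \<rho>2 \<Longrightarrow> C * t powr \<alpha> \<le> min \<kappa> (1 / 2)"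
    using powr_small[of "min \<kappa> (1 / 2)"] \<kappa> by auto
  obtain \<rho>3 where \<rho>3: "0 < \<rho>3" "C * \<rho>3 powr \<alpha> \<le> \<kappa> / (2 * B)"
    using powr_small[of "\<kappa> / (2 * B)"] \<kappa> B by force
  define \<eta> where "\<eta> = min \<rho>2 (\<tau> / (2 * B * C ^ 4))"
  have \<eta>: "0 < \<eta>" "C * \<eta> powr \<alpha> \<le> min \<kappa> (1 / 2)" "2 * B * C ^ 4 * \<eta> \<le> \<tau>"
  proof -
    show "0 < \<eta>"
      using \<rho>2 \<tau> B C by (simp add: \<eta>_def)
    then show "C * \<eta> powr \<alpha> \<le> min \<kappa> (1 / 2)"
      by (intro \<rho>2(2)) (auto simp: \<eta>_def)
    have "\<eta> \<le> \<tau> / (2 * B * C ^ 4)"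
      by (simp add: \<eta>_def)
    then show "2 * B * C ^ 4 * \<eta> \<le> \<tau>"
      using B C by (simp add: pos_le_divide_eq mult.commute)
  qed
  obtain n1 where n1: "\<And>n. n \<ge> n1 \<Longrightarrow> norm (z n - z0) < \<rho>1"
    using LIMSEQ_D[OF z_lim \<rho>1(1)] by auto
  obtain n2 where n2: "\<And>n. n \<ge> n2 \<Longrightarrow> \<eta>0 / Suc n \<le> \<eta>"
    using small[OF \<eta>(1)] by auto
  obtain n3 where n3: "\<And>i j. i \<ge> n3 \<Longrightarrow> j \<ge> n3 \<Longrightarrow>
      dist (((T \<circ> r1) \<circ> r2) i) (((T \<circ> r1) \<circ> r2) j) < \<kappa> / 2"
    using metric_CauchyD[OF cauchy, of "\<kappa> / 2"] \<kappa> by auto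
  \<comment> \<open>\<open>n1\<close> places \<open>z j\<close> near \<open>z0\<close>,
    \<open>n2\<close> makes the pair \<eta>-close, and \<open>n3\<close> puts its type in the Cauchy
    range.\<close>
  define j where "j = max n1 (max n2 n3)"
  define a b where "a = u j" and "b = v j"
  have ab: "a \<in> words N" "b \<in> words N"
    using words by (auto simp: a_def b_def)
  obtain e where e: "e \<in> words N" "\<And>x. x \<in> \<Omega> \<Longrightarrow> norm (W e x - z0) \<le> \<rho>3"
    using coding_near[OF z0 \<rho>3(1)] by auto
  define s where "s = e @ a"
  have s: "s \<in> words N"
    using e ab by (simp add: s_def)
  have "norm (W s x - z0) \<le> \<rho>3" if "x \<in> \<Omega>" for x
    using e(2)[OF W_in_\<Omega>[OF ab(1) that]] by (simp add: s_def word_map_append)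
  then obtain n where n: "norm (D (concat (replicate (Suc n) s)) z0
      - norm (D (concat (replicate (Suc n) s)) z0) *\<^sub>R id_blinfun)
    \<le> (\<kappa> / 2 + 2 * C * \<rho>3 powr \<alpha>) * norm (D (concat (replicate (Suc n) s)) z0)"
    using power_word_near_scalar[OF s F_sub_K[OF z0], of \<rho>3 "\<kappa> / 2"] \<kappa> by auto
  \<comment> \<open>Now \<open>k @ a\<close> is the power of \<open>s\<close> with exponent
    \<open>Suc n\<close>, and \<open>k\<close> begins with \<open>e\<close>, which keeps its image
    near \<open>z0\<close> even for \<open>n = 0\<close>.\<close>
  define k where "k = concat (replicate n s) @ e"
  have rep: "concat (replicate m s) \<in> words N" for m
    using s by (induction m) auto
  have k: "k \<in> words N"
    using rep e by (simp add: k_def)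
  have "concat (replicate (Suc n) s) = concat (replicate n s @ [s])"
    by (simp only: replicate_append_same replicate_Suc)
  then have ka: "concat (replicate (Suc n) s) = k @ a"
    by (simp add: k_def s_def)
  have near: "norm (W k x - z0) \<le> \<rho>3" if x: "x \<in> \<Omega>" for x
  proof (cases n)
    case 0
    then show ?thesis using e(2)[OF x] by (simp add: k_def)
  next
    case (Suc n')
    then have "W k x = W e (W (a @ concat (replicate n' s) @ e) x)"
      by (simp add: k_def s_def word_map_append)
    moreover have "a @ concat (replicate n' s) @ e \<in> words N"
      using rep e ab by simp
    ultimately show ?thesis
      using e(2)[OF W_in_\<Omega>[OF _ x]] by simp
  qed
  have B\<rho>3: "2 * B * C * \<rho>3 powr \<alpha> \<le> \<kappa>"
    using \<rho>3(2) B by (simp add: field_simps)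
  \<comment> \<open>As \<open>B \<ge> 2\<close>, the distortion term takes at most half of \<kappa>;
    the other half is the tolerance of the compactness step.\<close>
  have "2 * (C * \<rho>3 powr \<alpha>) \<le> B * (C * \<rho>3 powr \<alpha>)"
    using B C by (intro mult_right_mono) auto
  then have "\<kappa> / 2 + 2 * C * \<rho>3 powr \<alpha> \<le> \<kappa>"
    using B\<rho>3 by simp
  then have scalar: "norm (D (k @ a) z0 - norm (D (k @ a) z0) *\<^sub>R id_blinfun) \<le> \<kappa> * norm (D (k @ a) z0)"
    using n unfolding ka by (meson mult_right_mono norm_ge_zero order_trans)
  \<comment> \<open>The first entry keeps the exchange of \<open>u i\<close> for \<open>v i\<close>
    small at the scale of \<open>k @ a\<close>; the second keeps the values distinct, its
    \<open>4 * C ^ 3\<close> giving a strict inequality with \<open>2 * C ^ 3\<close>.\<close>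
  define \<eta>1 where "\<eta>1 = min (\<eta> * nrm k * nrm a) (nrm k * norm (W a (z j) - W b (z j)) / (4 * C ^ 3))"
  have \<eta>1: "0 < \<eta>1"
    using \<eta> nrm_pos k ab ne[of j] C by (auto simp: \<eta>1_def a_def b_def)
  obtain n4 where n4: "\<And>n. n \<ge> n4 \<Longrightarrow> \<eta>0 / Suc n \<le> \<eta>1"
    using small[OF \<eta>1] by auto
  \<comment> \<open>\<open>n3\<close> aligns the type with that of \<open>(a, b)\<close>;
    \<open>n4\<close> achieves the closeness \<open>\<eta>1\<close>, which depends on
    \<open>a\<close>, \<open>b\<close> and \<open>k\<close>.\<close>
  define i where "i = max n3 n4"
  define p q where "p = u i @ k @ b" and "q = v i @ k @ a"
  note swap = swapped_words_close[of a b k "u i" "v i" "z j" z0 \<kappa> B \<eta> \<eta>1 \<rho>3, folded p_def q_def]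
  have hyps:
    "C * norm (z j - z0) powr \<alpha> \<le> \<kappa>"
    "nrm b \<le> B * nrm a" "nrm a \<le> B * nrm b" "nrm (v i) \<le> B * nrm (u i)"
    "\<And>x. x \<in> F \<Longrightarrow> norm (W a x - W b x) \<le> \<eta> * nrm a"
    "W a (z j) \<noteq> W b (z j)"
    "\<And>x. x \<in> F \<Longrightarrow> norm (W (u i) x - W (v i) x) \<le> \<eta>1 * nrm (u i)"
    "\<eta>1 \<le> \<eta> * nrm k * nrm a" "2 * C ^ 3 * \<eta>1 < nrm k * norm (W a (z j) - W b (z j))"
    "norm (D (u i) z0 /\<^sub>R nrm (u i) - D a z0 /\<^sub>R nrm a) \<le> \<kappa> / 2"
    "norm (D (v i) z0 /\<^sub>R nrm (u i) - D b z0 /\<^sub>R nrm a) \<le> \<kappa> / 2"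
  proof -
    show "C * norm (z j - z0) powr \<alpha> \<le> \<kappa>"
      using n1[of j] by (intro \<rho>1(2)) (auto simp: j_def)
    show "nrm b \<le> B * nrm a" "nrm a \<le> B * nrm b" "nrm (v i) \<le> B * nrm (u i)"
      using nrm_uv by (auto simp: a_def b_def)
    show "norm (W a x - W b x) \<le> \<eta> * nrm a" if "x \<in> F" for x
    proof -
      have "\<eta>0 / Suc j * nrm a \<le> \<eta> * nrm a"
        using n2[of j] nrm_pos[OF ab(1)] by (intro mult_right_mono) (auto simp: j_def)
      then show ?thesis
        using close[OF that, of j] by (simp add: a_def b_def)
    qed
    show "W a (z j) \<noteq> W b (z j)"
      using ne by (simp add: a_def b_def)
    show "norm (W (u i) x - W (v i) x) \<le> \<eta>1 * nrm (u i)" if "x \<in> F" for x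
    proof -
      have "\<eta>0 / Suc i * nrm (u i) \<le> \<eta>1 * nrm (u i)"
        using n4[of i] less_imp_le[OF nrm_pos[OF words(1)]] by (intro mult_right_mono) (auto simp: i_def)
      then show ?thesis
        using close[OF that, of i] by simp
    qed
    show "\<eta>1 \<le> \<eta> * nrm k * nrm a"
      by (simp add: \<eta>1_def)
    have "4 * C ^ 3 * \<eta>1 \<le> nrm k * norm (W a (z j) - W b (z j))"
      using C by (simp add: \<eta>1_def min_def field_simps)
    moreover have "2 * C ^ 3 * \<eta>1 < 4 * C ^ 3 * \<eta>1"
      using C \<eta>1 by simp
    ultimately show "2 * C ^ 3 * \<eta>1 < nrm k * norm (W a (z j) - W b (z j))"
      by linarith
    have dist: "dist (((T \<circ> r1) \<circ> r2) i) (((T \<circ> r1) \<circ> r2) j) \<le> \<kappa> / 2"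
    proof -
      have "n3 \<le> i" "n3 \<le> j"
        by (auto simp: i_def j_def)
      then show ?thesis
        using n3 less_imp_le by blast
    qed
    show "norm (D (u i) z0 /\<^sub>R nrm (u i) - D a z0 /\<^sub>R nrm a) \<le> \<kappa> / 2"
      using order_trans[OF dist_fst_le dist] by (simp add: T_def u_def v_def a_def b_def dist_norm)
    show "norm (D (v i) z0 /\<^sub>R nrm (u i) - D b z0 /\<^sub>R nrm a) \<le> \<kappa> / 2"
      using order_trans[OF dist_snd_le dist] by (simp add: T_def u_def v_def a_def b_def dist_norm)
  qed
  have pq: "p \<in> words N" "q \<in> words N"
    using words k ab by (auto simp: p_def q_def)
  have "W p (z j) \<noteq> W q (z j)"
    by (rule swap(1)) (fact ab k words zF z0 B hyps \<eta> near B\<rho>3 scalar)+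
  moreover have "norm (W p (z j) - W q (z j)) \<le> \<tau> * nrm p"
  proof -
    have "norm (W p (z j) - W q (z j)) \<le> 2 * B * C ^ 4 * \<eta> * nrm p"
      by (rule swap(2)) (fact ab k words zF z0 B hyps \<eta> near B\<rho>3 scalar)+
    also have "\<dots> \<le> \<tau> * nrm p"
      using \<eta>(3) nrm_pos[OF pq(1)] by (intro mult_right_mono) auto
    finally show ?thesis .
  qed
  moreover have "norm (D p (z j) - D q (z j)) \<le> \<tau> * nrm p"
  proof -
    have "norm (D p (z j) - D q (z j)) \<le> 7 * B\<^sup>2 * C ^ 4 * \<kappa> * nrm p"
      by (rule swap(3)) (fact ab k words zF z0 B hyps \<eta> near B\<rho>3 scalar)+
    also have "7 * B\<^sup>2 * C ^ 4 * \<kappa> = \<tau>"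
      using B C by (simp add: \<kappa>_def)
    finally show ?thesis .
  qed
  ultimately show ?thesis
    using zF pq by blast
qed

section \<open>Zooming in at a near-tangency\<close>

text \<open>After precomposition with \<open>w\<close> the difference \<open>h'\<close> has size
  \<open>U * t\<close> at the preimage of \<open>z\<close>, and it varies by at most the gap of the
  differentials times \<open>nrm w * R\<close>. With \<open>nrm w\<close> of order
  \<open>M * t\<close> the ratio \<delta> of \<open>t\<close> to \<open>nrm w\<close> stays below
  \<epsilon>, while a small \<tau> keeps the variation below half of the value.\<close>

lemma zoom:
  assumes "0 < \<epsilon>"
  shows "\<exists>\<tau>>0. \<forall>u\<in>words N. \<forall>v\<in>words N. \<forall>z\<in>F. W u z \<noteq> W v z \<and>
      norm (W u z - W v z) \<le> \<tau> * nrm u \<and> norm (D u z - D v z) \<le> \<tau> * nrm u \<longrightarrow>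
    (\<exists>\<delta>>0. \<delta> < \<epsilon> \<and> (\<exists>w\<in>words N. \<forall>x\<in>\<Omega>.
       inverse (4 * C ^ 3) * \<delta> * max (nrm (u @ w)) (nrm (v @ w)) \<le> norm (W (u @ w) x - W (v @ w) x) \<and>
       norm (W (u @ w) x - W (v @ w) x) \<le> 4 * C ^ 3 * \<delta> * min (nrm (u @ w)) (nrm (v @ w))))"
proof -
  have C: "0 < C" "1 \<le> C"
    using C_ge_1 by auto
  define \<mu> where "\<mu> = m / C\<^sup>2"
  have \<mu>: "0 < \<mu>"
    using m C by (simp add: \<mu>_def)
  \<comment> \<open>Makes \<open>\<mu> * M = 2 / \<epsilon>\<close>, hence
    \<open>\<delta> \<le> \<epsilon> / 2\<close>.\<close>
  define M where "M = 2 / (\<mu> * \<epsilon>)"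
  have M: "0 < M"
    using \<mu> assms by (simp add: M_def)
  \<comment> \<open>The constant 12 leaves a quarter of the value for the distortion share
    \<open>3 * C * (C * \<rho> powr \<alpha>)\<close> of the variation.\<close>
  obtain \<rho> where \<rho>: "0 < \<rho>" "C * \<rho> powr \<alpha> \<le> 1 / (12 * C * M * R)"
    using powr_small[of "1 / (12 * C * M * R)"] C M R by force
  \<comment> \<open>The entries provide, in turn, an admissible scale \<open>M * t < 1\<close>,
    comparability of \<open>norm (D v z)\<close> with \<open>U\<close>, a quarter of the value for
    the gap at \<open>z\<close>, and an image of \<open>W w\<close> within \<rho> of
    \<open>z\<close>.\<close>
  define \<tau> where "\<tau> = min (min (1 / (2 * M)) (1 / (2 * C))) (min (1 / (4 * M * R)) (\<rho> / (M * R)))"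
  have \<tau>: "0 < \<tau>"
    using M R C \<rho> by (simp add: \<tau>_def)
  have \<tau>_le: "M * \<tau> \<le> 1 / 2" "\<tau> \<le> 1 / (2 * C)" "\<tau> * (M * R) \<le> 1 / 4" "M * \<tau> * R \<le> \<rho>"
  proof -
    have "\<tau> \<le> 1 / (2 * M)" "\<tau> \<le> 1 / (2 * C)" "\<tau> \<le> 1 / (4 * M * R)" "\<tau> \<le> \<rho> / (M * R)"
      by (simp_all add: \<tau>_def)
    then show "M * \<tau> \<le> 1 / 2" "\<tau> \<le> 1 / (2 * C)" "\<tau> * (M * R) \<le> 1 / 4" "M * \<tau> * R \<le> \<rho>"
      using M R(1) by (simp_all add: pos_le_divide_eq mult_ac)
  qed
  show ?thesis
  proof (rule exI[of _ \<tau>], intro conjI ballI impI \<tau>)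
    fix u v z assume words: "u \<in> words N" "v \<in> words N" and z: "z \<in> F"
      and "W u z \<noteq> W v z \<and> norm (W u z - W v z) \<le> \<tau> * nrm u \<and> norm (D u z - D v z) \<le> \<tau> * nrm u"
    then have ne: "W u z \<noteq> W v z" and h: "norm (W u z - W v z) \<le> \<tau> * nrm u"
      and Dh: "norm (D u z - D v z) \<le> \<tau> * nrm u"
      by auto
    define U where "U = nrm u"
    have U: "0 < U"
      using nrm_pos words by (simp add: U_def)
    define t where "t = norm (W u z - W v z) / U"
    have t: "0 < t" "t \<le> \<tau>" and ht: "norm (W u z - W v z) = U * t"
      using ne h U by (auto simp: t_def U_def pos_divide_le_eq)
    have zK: "z \<in> K" and z\<Omega>: "z \<in> \<Omega>"
      using z F_sub_K F_sub_\<Omega> by auto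
    have Mt: "M * t \<le> M * \<tau>"
      using t M by (intro mult_left_mono) auto
    then have "0 < M * t" "M * t < 1"
      using order_le_less_trans[OF order_trans[OF Mt \<tau>_le(1)], of 1] t M by auto
    then obtain w where w: "w \<in> words N" "z \<in> W w ` F" "nrm w \<le> M * t" "\<mu> * (M * t) \<le> nrm w"
      using coding_at_scale[OF z, of "M * t"] unfolding \<mu>_def by auto
    define \<omega> where "\<omega> = nrm w"
    have \<omega>: "0 < \<omega>"
      using nrm_pos w by (simp add: \<omega>_def)
    obtain y where y: "y \<in> F" "z = W w y"
      using w by auto
    \<comment> \<open>The gap relative to \<open>U * \<omega>\<close>, which is comparable to the
      norms of both extended words.\<close>
    define \<delta> where "\<delta> = t / \<omega>"
    have \<delta>: "0 < \<delta>"
      using t \<omega> by (simp add: \<delta>_def)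
    have Ut: "U * t = \<delta> * (U * \<omega>)"
      using \<omega> by (simp add: \<delta>_def)
    have "\<mu> * M = 2 / \<epsilon>"
      using \<mu> by (simp add: M_def)
    then have "2 / \<epsilon> * t \<le> \<omega>"
      using w(4) by (simp add: \<omega>_def mult.assoc[symmetric])
    then have "2 * t \<le> \<epsilon> * \<omega>"
      using assms by (simp add: field_simps)
    then have "\<delta> \<le> \<epsilon> / 2"
      using \<omega> by (simp add: \<delta>_def field_simps)
    then have \<delta>\<epsilon>: "\<delta> < \<epsilon>"
      using assms by simp
    have "norm (D v z) \<le> norm (D u z) + norm (D u z - D v z)"
      "norm (D u z) \<le> norm (D v z) + norm (D u z - D v z)"
      by norm+
    moreover have "\<tau> * U \<le> 1 / (2 * C) * U"
      using \<tau>_le U by (intro mult_right_mono) auto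
    moreover have "1 / (2 * C) * U \<le> 1 * U"
      using C U by (intro mult_right_mono) auto
    moreover have "U / C \<le> norm (D u z)" "norm (D u z) \<le> U"
      using nrm_le_C[OF words(1) zK] norm_D_le_nrm[OF words(1) z\<Omega>] C by (auto simp: U_def field_simps)
    ultimately have Dv: "norm (D v z) \<le> 2 * U" "U / (2 * C) \<le> norm (D v z)"
      using Dh by (auto simp: U_def)
    have vU: "nrm v \<le> 2 * C * U" "U / (2 * C) \<le> nrm v"
      using order_trans[OF nrm_le_C[OF words(2) zK] mult_left_mono[OF Dv(1)]] C
        Dv(2) norm_D_le_nrm[OF words(2) z\<Omega>] by auto
    define h' where "h' x = W u (W w x) - W v (W w x)" for x
    have \<omega>R: "\<omega> * R \<le> \<rho>"
    proof -
      have "\<omega> * R \<le> (M * \<tau>) * R"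
        using w(3) Mt R by (intro mult_right_mono) (auto simp: \<omega>_def)
      then show ?thesis using \<tau>_le by simp
    qed
    \<comment> \<open>At \<open>z\<close> the gap is at most \<open>\<tau> * U\<close>; distortion
      adds one unit for \<open>u\<close> and at most \<open>2 * C\<close> units for
      \<open>v\<close>, together at most \<open>3 * C\<close>.\<close>
    define \<sigma> where "\<sigma> = (\<tau> + 3 * C * (C * \<rho> powr \<alpha>)) * U"
    have \<sigma>: "norm (D u (W w x) - D v (W w x)) \<le> \<sigma>" if x: "x \<in> \<Omega>" for x
    proof -
      define x' where "x' = W w x"
      have x': "x' \<in> \<Omega>"
        using W_in_\<Omega> w x by (simp add: x'_def)
      have "norm (x' - z) \<le> \<omega> * R"
        using W_diameter[OF w(1) x F_sub_\<Omega>[OF y(1)]] y by (simp add: x'_def \<omega>_def)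
      then have dist: "C * norm (x' - z) powr \<alpha> \<le> C * \<rho> powr \<alpha>"
        using \<omega>R C hoelder(1) by (intro mult_left_mono powr_mono2) auto
      have "norm (D u x' - D u z) \<le> (C * \<rho> powr \<alpha>) * U"
        unfolding U_def by (rule order_trans[OF distortion'[OF words(1) x' zK] mult_right_mono[OF dist]])
          (use nrm_pos[OF words(1)] in simp)
      moreover have "norm (D v x' - D v z) \<le> (C * \<rho> powr \<alpha>) * nrm v"
        by (rule order_trans[OF distortion'[OF words(2) x' zK] mult_right_mono[OF dist]])
          (use nrm_pos[OF words(2)] in simp)
      moreover have "(C * \<rho> powr \<alpha>) * nrm v \<le> (C * \<rho> powr \<alpha>) * (2 * C * U)"
        using vU C by (intro mult_left_mono) auto
      moreover have "(C * \<rho> powr \<alpha>) * U * 1 \<le> (C * \<rho> powr \<alpha>) * U * C"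
        using C U by (intro mult_left_mono) auto
      moreover have "norm (D u x' - D v x') \<le> norm (D u z - D v z) + norm (D u x' - D u z) + norm (D v x' - D v z)"
        by norm
      ultimately show ?thesis
        using Dh by (simp add: \<sigma>_def x'_def U_def algebra_simps)
    qed
    have \<sigma>_small: "\<sigma> * \<omega> * R \<le> U * t / 2"
    proof -
      define L where "L = \<tau> + 3 * C * (C * \<rho> powr \<alpha>)"
      have \<sigma>_L: "\<sigma> = L * U" and L: "0 \<le> L"
        using \<tau> C by (auto simp: \<sigma>_def L_def)
      have "C * \<rho> powr \<alpha> * (12 * C * M * R) \<le> 1"
        using \<rho>(2) C M R(1) by (simp add: pos_le_divide_eq)
      then have "L * (M * R) \<le> 1 / 2"
        using \<tau>_le(3) by (simp add: L_def algebra_simps)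
      then have "L * (M * R) * (U * t) \<le> 1 / 2 * (U * t)"
        using U t by (intro mult_right_mono) auto
      moreover have "\<sigma> * \<omega> * R \<le> \<sigma> * (M * t) * R"
        using w(3) R(1) L U by (intro mult_right_mono mult_left_mono) (auto simp: \<omega>_def \<sigma>_L)
      ultimately show ?thesis
        by (simp add: \<sigma>_L mult_ac)
    qed
    have variation: "norm (h' x - h' y) \<le> U * t / 2" if x: "x \<in> \<Omega>" for x
    proof -
      have "norm (h' x - h' y) \<le> (\<sigma> * \<omega>) * norm (x - y)"
      proof (rule differentiable_bound[OF convex_\<Omega> _ _ x F_sub_\<Omega>[OF y(1)]])
        fix x' assume x': "x' \<in> \<Omega>"
        have der: "((\<lambda>x. W u' (W w x)) has_derivative blinfun_apply (D u' (W w x') o\<^sub>L D w x')) (at x')"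
          if "u' \<in> words N" for u'
          using W_has_derivative[of "u' @ w" x'] that w x' D_append[OF that w(1) x']
          by (simp add: word_map_append o_def)
        have "(h' has_derivative (\<lambda>y. (D u (W w x') o\<^sub>L D w x') y - (D v (W w x') o\<^sub>L D w x') y)) (at x')"
          unfolding h'_def by (rule has_derivative_diff[OF der[OF words(1)] der[OF words(2)]])
        then have "(h' has_derivative blinfun_apply ((D u (W w x') - D v (W w x')) o\<^sub>L D w x')) (at x')"
          by (simp add: blinfun_compose.rep_eq minus_blinfun.rep_eq o_def)
        then show "(h' has_derivative blinfun_apply ((D u (W w x') - D v (W w x')) o\<^sub>L D w x')) (at x' within \<Omega>)"
          by (rule has_derivative_at_withinI)
        show "onorm (blinfun_apply ((D u (W w x') - D v (W w x')) o\<^sub>L D w x')) \<le> \<sigma> * \<omega>"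
          unfolding norm_blinfun.rep_eq[symmetric] \<omega>_def
          by (intro blinfun_compose_mono \<sigma> x' norm_D_le_nrm w)
      qed
      also have "\<dots> \<le> (\<sigma> * \<omega>) * R"
        using R(2)[OF x F_sub_\<Omega>[OF y(1)]] \<tau> C U \<omega> by (intro mult_left_mono) (auto simp: \<sigma>_def)
      finally show ?thesis using \<sigma>_small by simp
    qed
    have h'_y: "norm (h' y) = U * t"
      using ht y by (simp add: h'_def)
    have up: "nrm (u @ w) \<le> U * \<omega>" "nrm (v @ w) \<le> 2 * C * U * \<omega>"
      using nrm_append_le[OF words(1) w(1)] order_trans[OF nrm_append_le[OF words(2) w(1)] mult_right_mono[OF vU(1)]] \<omega>
      by (auto simp: U_def \<omega>_def)
    have max_le: "max (nrm (u @ w)) (nrm (v @ w)) \<le> 2 * C * (U * \<omega>)"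
    proof -
      have "1 * (U * \<omega>) \<le> 2 * C * (U * \<omega>)"
        using C U \<omega> by (intro mult_right_mono) auto
      then show ?thesis using up by simp
    qed
    have min_ge: "U * \<omega> \<le> 2 * C ^ 3 * min (nrm (u @ w)) (nrm (v @ w))"
    proof -
      have "U * \<omega> \<le> C\<^sup>2 * nrm (u @ w)"
        using nrm_append_ge[OF words(1) w(1)] by (simp add: U_def \<omega>_def)
      also have "\<dots> \<le> 2 * C ^ 3 * nrm (u @ w)"
      proof (rule mult_right_mono)
        have "0 < C ^ 3" "C\<^sup>2 \<le> C ^ 3"
          using C power_increasing[of 2 3 C] by auto
        then show "C\<^sup>2 \<le> 2 * C ^ 3"
          by linarith
      qed (use nrm_pos[of "u @ w"] words w in auto)
      finally have 1: "U * \<omega> \<le> 2 * C ^ 3 * nrm (u @ w)" .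
      have "U / (2 * C) * \<omega> \<le> C\<^sup>2 * nrm (v @ w)"
        using nrm_append_ge[OF words(2) w(1)] mult_right_mono[OF vU(2), of \<omega>] \<omega> by (simp add: \<omega>_def)
      then have "U * \<omega> \<le> 2 * C ^ 3 * nrm (v @ w)"
        using C by (simp add: field_simps power2_eq_square power3_eq_cube)
      with 1 show ?thesis by (simp add: min_def)
    qed
    show "\<exists>\<delta>>0. \<delta> < \<epsilon> \<and> (\<exists>w\<in>words N. \<forall>x\<in>\<Omega>.
       inverse (4 * C ^ 3) * \<delta> * max (nrm (u @ w)) (nrm (v @ w)) \<le> norm (W (u @ w) x - W (v @ w) x) \<and>
       norm (W (u @ w) x - W (v @ w) x) \<le> 4 * C ^ 3 * \<delta> * min (nrm (u @ w)) (nrm (v @ w)))"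
    proof (intro exI[of _ \<delta>] conjI \<delta> \<delta>\<epsilon> bexI[of _ w] w(1) ballI)
      fix x assume x: "x \<in> \<Omega>"
      have h'_eq: "W (u @ w) x - W (v @ w) x = h' x"
        by (simp add: h'_def word_map_append)
      have low: "\<delta> * (U * \<omega>) / 2 \<le> norm (h' x)" and high: "norm (h' x) \<le> 2 * \<delta> * (U * \<omega>)"
        using variation[OF x] h'_y norm_triangle_ineq2[of "h' x" "h' y"] norm_triangle_ineq2[of "h' y" "h' x"]
          \<delta> U \<omega> by (auto simp: Ut norm_minus_commute)
      \<comment> \<open>The lower bound already holds with \<open>4 * C\<close>; the cube comes from
        the upper bound through \<open>min_ge\<close>.\<close>
      have "inverse (4 * C ^ 3) * \<delta> * max (nrm (u @ w)) (nrm (v @ w)) \<le> inverse (4 * C) * \<delta> * (2 * C * (U * \<omega>))"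
      proof (rule mult_mono[OF _ max_le])
        show "inverse (4 * C ^ 3) * \<delta> \<le> inverse (4 * C) * \<delta>"
          using C \<delta> power_increasing[of 1 3 C] by (intro mult_right_mono le_imp_inverse_le) auto
      qed (use C \<delta> less_imp_le[OF nrm_pos[of "u @ w"]] words w in \<open>auto simp: le_max_iff_disj\<close>)
      also have "\<dots> = \<delta> * (U * \<omega>) / 2"
        using C by (simp add: field_simps)
      also note low
      finally show "inverse (4 * C ^ 3) * \<delta> * max (nrm (u @ w)) (nrm (v @ w)) \<le> norm (W (u @ w) x - W (v @ w) x)"
        unfolding h'_eq .
      have "2 * \<delta> * (U * \<omega>) \<le> 2 * \<delta> * (2 * C ^ 3 * min (nrm (u @ w)) (nrm (v @ w)))"
        using min_ge \<delta> by (intro mult_left_mono) auto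
      then show "norm (W (u @ w) x - W (v @ w) x) \<le> 4 * C ^ 3 * \<delta> * min (nrm (u @ w)) (nrm (v @ w))"
        unfolding h'_eq using high by (simp add: mult_ac)
    qed
  qed
qed

section \<open>From failure of the criterion to the conclusion\<close>

text \<open>An infimum that is not positive lies below \<open>ereal \<eta>\<close>, so some
  admissible pair does too; the empty family is excluded, its infimum being \<infinity>. Distinct
  restrictions supply \<open>z\<close>.\<close>

lemma close_words_if_not_criterion:
  assumes "\<not> identity_limit_criterion \<Omega> N \<phi> F" "0 < \<eta>"
  shows "\<exists>u\<in>words N. \<exists>v\<in>words N. \<exists>z\<in>F. W u z \<noteq> W v z \<and>
    (\<forall>x\<in>F. norm (W u x - W v x) \<le> \<eta> * nrm u)"
proof -
  define S where "S = {ereal (inverse (nrm u) * (SUP x\<in>F. norm (W u x - W v x))) | u v.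
      u \<in> words N \<and> v \<in> words N \<and> restrict (W u) F \<noteq> restrict (W v) F}"
  have "Inf S \<le> 0"
    using assms(1) unfolding identity_limit_criterion_def S_def by (simp add: not_less)
  also have "0 < ereal \<eta>"
    using assms(2) by simp
  finally obtain s where "s \<in> S" "s < ereal \<eta>"
    unfolding Inf_less_iff by blast
  then obtain u v where uv: "u \<in> words N" "v \<in> words N" "restrict (W u) F \<noteq> restrict (W v) F"
    and less: "inverse (nrm u) * (SUP x\<in>F. norm (W u x - W v x)) < \<eta>"
    unfolding S_def by auto
  obtain z where "z \<in> F" "W u z \<noteq> W v z"
    using uv(3) by (meson restrict_ext)
  moreover have "norm (W u x - W v x) \<le> \<eta> * nrm u" if x: "x \<in> F" for x
  proof -
    have "norm (W u x - W v x) \<le> (SUP x\<in>F. norm (W u x - W v x))"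
      by (intro cSUP_upper x bdd_aboveI2[where M = R] R(2) W_in_\<Omega> uv F_sub_\<Omega>)
    also have "\<dots> \<le> \<eta> * nrm u"
      using less nrm_pos[OF uv(1)] by (simp add: field_simps)
    finally show ?thesis .
  qed
  ultimately show ?thesis
    using uv by blast
qed

lemma separated_close_words:
  assumes "\<not> identity_limit_criterion \<Omega> N \<phi> F" "0 < \<epsilon>"
  shows "\<exists>\<delta>>0. \<delta> < \<epsilon> \<and> (\<exists>u\<in>words N. \<exists>v\<in>words N. \<forall>x\<in>\<Omega>.
    inverse (4 * C ^ 3) * \<delta> * max (nrm u) (nrm v) \<le> norm (W u x - W v x) \<and>
    norm (W u x - W v x) \<le> 4 * C ^ 3 * \<delta> * min (nrm u) (nrm v))"
proof -
  from zoom[OF assms(2)] obtain \<tau> where \<tau>: "0 < \<tau>"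
    and zoom_\<tau>: "\<forall>u\<in>words N. \<forall>v\<in>words N. \<forall>z\<in>F. W u z \<noteq> W v z \<and>
        norm (W u z - W v z) \<le> \<tau> * nrm u \<and> norm (D u z - D v z) \<le> \<tau> * nrm u \<longrightarrow>
      (\<exists>\<delta>>0. \<delta> < \<epsilon> \<and> (\<exists>w\<in>words N. \<forall>x\<in>\<Omega>.
         inverse (4 * C ^ 3) * \<delta> * max (nrm (u @ w)) (nrm (v @ w)) \<le> norm (W (u @ w) x - W (v @ w) x) \<and>
         norm (W (u @ w) x - W (v @ w) x) \<le> 4 * C ^ 3 * \<delta> * min (nrm (u @ w)) (nrm (v @ w))))"
    by (elim exE conjE)
  obtain u v z where uv: "u \<in> words N" "v \<in> words N" and "z \<in> F" "W u z \<noteq> W v z \<and>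
      norm (W u z - W v z) \<le> \<tau> * nrm u \<and> norm (D u z - D v z) \<le> \<tau> * nrm u"
    using near_tangent_pair[OF close_words_if_not_criterion[OF assms(1)] \<tau>] by blast
  with zoom_\<tau> obtain \<delta> w where "0 < \<delta>" "\<delta> < \<epsilon>" "w \<in> words N" and bounds: "\<forall>x\<in>\<Omega>.
      inverse (4 * C ^ 3) * \<delta> * max (nrm (u @ w)) (nrm (v @ w)) \<le> norm (W (u @ w) x - W (v @ w) x) \<and>
      norm (W (u @ w) x - W (v @ w) x) \<le> 4 * C ^ 3 * \<delta> * min (nrm (u @ w)) (nrm (v @ w))"
    by blast
  moreover have "u @ w \<in> words N" "v @ w \<in> words N"
    using uv \<open>w \<in> words N\<close> by auto
  ultimately show ?thesis
    by blast
qed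

end

section \<open>Conformal iterated function systems\<close>

lemma conformal_ifs_imp_attractor:
  fixes \<Omega> V F :: "'a::euclidean_space set"
  assumes ifs: "conformal_ifs \<Omega> N \<phi>" and attractor: "self_conformal_set \<Omega> N \<phi> F"
    and two: "\<exists>x\<in>F. \<exists>y\<in>F. x \<noteq> y"
    and V: "bounded V" "\<forall>i\<in>{1..N}. \<phi> i ` closure V \<subseteq> V" "closure V \<subseteq> \<Omega>"
  shows "\<exists>lam \<alpha> c m R. conformal_attractor \<Omega> (F \<union> closure V) N \<phi> lam \<alpha> c m R F"
proof -
  have \<Omega>: "\<Omega> \<noteq> {}" "bounded \<Omega>" "open \<Omega>" "convex \<Omega>"
    and \<phi>: "\<And>i. i \<in> {1..N} \<Longrightarrow> inj_on (\<phi> i) \<Omega>" "\<And>i. i \<in> {1..N} \<Longrightarrow> conformal_on \<Omega> (\<phi> i)"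
      "\<And>i. i \<in> {1..N} \<Longrightarrow> closure (\<phi> i ` \<Omega>) \<subseteq> \<Omega>" "\<And>i. i \<in> {1..N} \<Longrightarrow> deriv_norm \<Omega> (\<phi> i) < 1"
    using ifs by (auto simp: conformal_ifs_def)
  have F: "F \<noteq> {}" "compact F" "F \<subseteq> \<Omega>" "F = (\<Union>i\<in>{1..N}. \<phi> i ` F)"
    using attractor by (auto simp: self_conformal_set_def)
  define K where "K = F \<union> closure V"
  have K: "compact K" "K \<subseteq> \<Omega>" "K \<noteq> {}"
    using F V by (auto simp: K_def)
  have K_inv: "\<phi> i x \<in> K" if "i \<in> {1..N}" "x \<in> K" for i x
    using that F(4) V(2) closure_subset[of V] unfolding K_def by blast
  have maps: "\<phi> i x \<in> \<Omega>" if "i \<in> {1..N}" "x \<in> \<Omega>" for i x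
    using \<phi>(3)[OF that(1)] closure_subset that by blast
  have sim: "similarity (differential (\<phi> i) x)" if "i \<in> {1..N}" "x \<in> \<Omega>" for i x
  proof -
    have *: "norm (blinfun_apply (differential (\<phi> i) x) y) = norm (differential (\<phi> i) x) * norm y \<and>
        norm (differential (\<phi> i) x) * norm y \<noteq> 0" if "y \<noteq> 0" for y
      using \<phi>(2)[OF \<open>i \<in> {1..N}\<close>] \<open>x \<in> \<Omega>\<close> that by (simp add: conformal_on_def)
    obtain y :: 'a where "y \<in> Basis"
      using nonempty_Basis by blast
    then have "y \<noteq> 0"
      by (rule nonzero_Basis)
    then have "differential (\<phi> i) x \<noteq> 0"
      using * by auto
    moreover have "norm (blinfun_apply (differential (\<phi> i) x) y) = norm (differential (\<phi> i) x) * norm y" for y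
      using *[of y] by (cases "y = 0") auto
    ultimately show ?thesis
      by (simp add: similarity_def)
  qed
  obtain r where r: "0 < r" "\<And>x. x \<in> \<Omega> \<Longrightarrow> norm x \<le> r"
    using \<Omega>(2) unfolding bounded_pos by blast
  \<comment> \<open>The summand 1 secures \<open>1 \<le> R\<close> for
    \<open>hoelder_exponent_decrease\<close>.\<close>
  define R where "R = 2 * r + 1"
  have R: "1 \<le> R" "\<And>x y. x \<in> \<Omega> \<Longrightarrow> y \<in> \<Omega> \<Longrightarrow> norm (x - y) \<le> R"
  proof -
    show "1 \<le> R" using r by (simp add: R_def)
    fix x y assume "x \<in> \<Omega>" "y \<in> \<Omega>"
    then have "norm x \<le> r" "norm y \<le> r" using r by auto
    then show "norm (x - y) \<le> R"
      using norm_triangle_ineq4[of x y] by (simp add: R_def)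
  qed
  \<comment> \<open>A single parameter encodes exponent and constant, so one minimum makes both
    uniform in \<open>i\<close>.\<close>
  have "\<exists>e>0. \<forall>i\<in>{1..N}. \<forall>x\<in>\<Omega>. \<forall>y\<in>\<Omega>.
      norm (differential (\<phi> i) x - differential (\<phi> i) y) \<le> 1 / e * norm (x - y) powr e"
  proof (rule finite_uniform_pos)
    fix i assume i: "i \<in> {1..N}"
    have "\<exists>\<alpha>>0. \<exists>c>0. \<forall>x\<in>\<Omega>. \<forall>y\<in>\<Omega>.
        norm (differential (\<phi> i) x - differential (\<phi> i) y) \<le> c * norm (x - y) powr \<alpha>"
      using \<phi>(2)[OF i] by (simp add: conformal_on_def)
    then obtain \<alpha> c where *: "0 < \<alpha>" "0 < c" "\<And>x y. x \<in> \<Omega> \<Longrightarrow> y \<in> \<Omega> \<Longrightarrow>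
        norm (differential (\<phi> i) x - differential (\<phi> i) y) \<le> c * norm (x - y) powr \<alpha>"
      by blast
    show "\<exists>d>0. \<forall>e. 0 < e \<longrightarrow> e \<le> d \<longrightarrow> (\<forall>x\<in>\<Omega>. \<forall>y\<in>\<Omega>.
        norm (differential (\<phi> i) x - differential (\<phi> i) y) \<le> 1 / e * norm (x - y) powr e)"
    proof (intro exI[of _ "min \<alpha> (1 / (c * R powr \<alpha>))"] conjI allI impI ballI)
      fix e x y assume "0 < e" "e \<le> min \<alpha> (1 / (c * R powr \<alpha>))" and xy: "x \<in> \<Omega>" "y \<in> \<Omega>"
      then have "c * norm (x - y) powr \<alpha> \<le> 1 / e * norm (x - y) powr e"
        using R(1) R(2)[OF xy] * by (intro hoelder_exponent_decrease) auto
      then show "norm (differential (\<phi> i) x - differential (\<phi> i) y) \<le> 1 / e * norm (x - y) powr e"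
        using *(3)[OF xy] by simp
    qed (use * R in auto)
  qed simp
  then obtain e where e: "0 < e" "\<And>i x y. i \<in> {1..N} \<Longrightarrow> x \<in> \<Omega> \<Longrightarrow> y \<in> \<Omega> \<Longrightarrow>
      norm (differential (\<phi> i) x - differential (\<phi> i) y) \<le> 1 / e * norm (x - y) powr e"
    by blast
  \<comment> \<open>Hoelder continuity on the bounded set \<Omega> bounds the differentials, so the
    supremum dominates each value.\<close>
  have le_deriv_norm: "norm (differential (\<phi> i) x) \<le> deriv_norm \<Omega> (\<phi> i)" if i: "i \<in> {1..N}" and x: "x \<in> \<Omega>" for i x
    unfolding deriv_norm_def
  proof (rule cSUP_upper[OF x bdd_aboveI2])
    fix y assume y: "y \<in> \<Omega>"
    have "norm (differential (\<phi> i) y) \<le> norm (differential (\<phi> i) x) + norm (differential (\<phi> i) y - differential (\<phi> i) x)"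
      by norm
    also have "norm (differential (\<phi> i) y - differential (\<phi> i) x) \<le> 1 / e * R powr e"
      using e(1) R(2)[OF y x]
      by (intro order_trans[OF e(2)[OF i y x]] mult_left_mono powr_mono2) auto
    finally show "norm (differential (\<phi> i) y) \<le> norm (differential (\<phi> i) x) + 1 / e * R powr e"
      by simp
  qed
  \<comment> \<open>The contraction ratio will be \<open>1 - l\<close>; the clause
    \<open>l < 1\<close> keeps it positive.\<close>
  have "\<exists>l>0. \<forall>i\<in>{1..N}. l < 1 \<and> (\<forall>x\<in>\<Omega>. norm (differential (\<phi> i) x) \<le> 1 - l)"
  proof (rule finite_uniform_pos)
    fix i assume i: "i \<in> {1..N}"
    show "\<exists>d>0. \<forall>l. 0 < l \<longrightarrow> l \<le> d \<longrightarrow> l < 1 \<and> (\<forall>x\<in>\<Omega>. norm (differential (\<phi> i) x) \<le> 1 - l)"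
    proof (intro exI[of _ "min (1 / 2) (1 - deriv_norm \<Omega> (\<phi> i))"] conjI allI impI ballI)
      fix l x assume "l \<le> min (1 / 2) (1 - deriv_norm \<Omega> (\<phi> i))" "x \<in> \<Omega>"
      then show "norm (differential (\<phi> i) x) \<le> 1 - l"
        using le_deriv_norm[OF i, of x] by simp
    qed (use \<phi>(4)[OF i] in auto)
  qed simp
  then obtain l where l: "0 < l" "\<And>i. i \<in> {1..N} \<Longrightarrow> l < 1"
    "\<And>i x. i \<in> {1..N} \<Longrightarrow> x \<in> \<Omega> \<Longrightarrow> norm (differential (\<phi> i) x) \<le> 1 - l"
    by blast
  have "1 \<in> {1..N}"
    using ifs by (simp add: conformal_ifs_def)
  then have l1: "l < 1"
    by (rule l(2))
  \<comment> \<open>The continuous norm of a nonvanishing differential attains a positive minimum on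
    the compact set \<open>K\<close>.\<close>
  have "\<exists>m>0. \<forall>i\<in>{1..N}. \<forall>x\<in>K. m \<le> norm (differential (\<phi> i) x)"
  proof (rule finite_uniform_pos)
    fix i assume i: "i \<in> {1..N}"
    have "continuous_on K (\<lambda>x. norm (differential (\<phi> i) x))"
      using \<phi>(2)[OF i] K(2)
      by (intro continuous_on_norm) (auto simp: conformal_on_def intro: continuous_on_subset)
    then obtain x where x: "x \<in> K" "\<And>y. y \<in> K \<Longrightarrow> norm (differential (\<phi> i) x) \<le> norm (differential (\<phi> i) y)"
      using continuous_attains_inf[OF K(1,3)] by blast
    show "\<exists>d>0. \<forall>m. 0 < m \<longrightarrow> m \<le> d \<longrightarrow> (\<forall>x\<in>K. m \<le> norm (differential (\<phi> i) x))"
      using x similarity_norm_pos[OF sim[OF i, of x]] K(2)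
      by (intro exI[of _ "norm (differential (\<phi> i) x)"]) force
  qed simp
  then obtain m where m: "0 < m" "\<And>i x. i \<in> {1..N} \<Longrightarrow> x \<in> K \<Longrightarrow> m \<le> norm (differential (\<phi> i) x)"
    by blast
  have "conformal_attractor \<Omega> K N \<phi> (1 - l) e (1 / e) m R F"
  proof
    show "\<phi> i differentiable (at x)" if "i \<in> {1..N}" "x \<in> \<Omega>" for i x
      using \<phi>(2)[OF that(1)] that(2) by (simp add: conformal_on_def)
    show "F \<subseteq> K"
      by (simp add: K_def)
  qed (use \<Omega> R K K_inv maps \<phi>(1) sim l(1,3) l1 m e F(2,4) two in \<open>simp; fail\<close>)+
  then show ?thesis
    unfolding K_def by blast
qed

theorem lemma7p4:
  fixes \<Omega> V F :: "'a::euclidean_space set"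
    and N :: nat
    and \<phi> :: "nat \<Rightarrow> 'a \<Rightarrow> 'a"
  assumes "conformal_ifs \<Omega> N \<phi>"
    and "self_conformal_set \<Omega> N \<phi> F"
    and "\<exists>x\<in>F. \<exists>y\<in>F. x \<noteq> y"
    and "V \<noteq> {}" and "bounded V" and "open V" and "convex V"
    and "\<forall>i\<in>{1..N}. \<phi> i ` closure V \<subseteq> V" and "closure V \<subseteq> \<Omega>"
    and "\<not> identity_limit_criterion \<Omega> N \<phi> F"
  shows "\<exists>C\<ge>1. \<forall>\<epsilon>>0. \<exists>\<delta>. 0 < \<delta> \<and> \<delta> < \<epsilon> \<and>
    (\<exists>u\<in>words N. \<exists>v\<in>words N. \<forall>x\<in>V.
       inverse C * \<delta> * max (deriv_norm \<Omega> (word_map \<phi> u)) (deriv_norm \<Omega> (word_map \<phi> v))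
         \<le> norm (word_map \<phi> u x - word_map \<phi> v x) \<and>
       norm (word_map \<phi> u x - word_map \<phi> v x)
         \<le> C * \<delta> * min (deriv_norm \<Omega> (word_map \<phi> u)) (deriv_norm \<Omega> (word_map \<phi> v)))"
proof -
  obtain lam \<alpha> c m R where "conformal_attractor \<Omega> (F \<union> closure V) N \<phi> lam \<alpha> c m R F"
    using conformal_ifs_imp_attractor[OF assms(1-3,5,8,9)] by blast
  then interpret conformal_attractor \<Omega> "F \<union> closure V" N \<phi> lam \<alpha> c m R F .
  have "V \<subseteq> \<Omega>"
    using assms(9) closure_subset by blast
  \<comment> \<open>The final constant, with \<open>C\<close> the distortion constant of the
    interpreted locale, hence independent of \<epsilon>. The bounds hold on all of \<Omega> and
    restrict to \<open>V\<close>.\<close>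
  moreover have "1 \<le> 4 * C ^ 3"
    using one_le_power[OF C_ge_1, of 3] by simp
  ultimately show ?thesis
    using separated_close_words[OF assms(10)] by (meson subsetD)
qed

end
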